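(* For $\lambda>0$ let $U_\lambda:\mathbf{V}\to\mathbb{R}$ be the solution of the discrete equation $U(x)=\min_{e\in\mathbf{E},\,\mathrm{t}(e)=x}\rho_\lambda(U(\mathrm{o}(e)),e)$, $x\in\mathbf{V}$. Let $\lambda_n\to0^+$ be a sequence such that $U_{\lambda_n}$ converges to a function $V$ on $\mathbf{V}$. Then $V$ is a solution of $$V(x)=\min_{e\in\mathbf{E},\,\mathrm{t}(e)=x}\big(V(\mathrm{o}(e))+\sigma(e)\big),\qquad x\in\mathbf{V},$$ and satisfies $$V(x)=\min\{V(y)+\sigma(\xi):\ y\in\mathcal{B},\ \xi\text{ path joining }y\text{ to }x\}\qquad\text{for all }x\in\mathbf{V},$$ where $\mathcal{B}=\{y\in\mathbf{V}:\text{there is a sequence }\mu_n\to0^+\text{ with }y\in\mathcal{A}_{\mu_n}\text{ for all }n\}$ and $\mathcal{A}_\mu$ denotes the $\mu$-Aubry set.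
   Context: Network: $\Gamma=\bigcup_{\gamma\in\mathcal{E}}\gamma([0,1])\subset\mathbb{R}^N$, where $\mathcal{E}$ is a finite collection of regular simple curves $\gamma:[0,1]\to\mathbb{R}^N$ (arcs; closed arcs with $\gamma(0)=\gamma(1)$, and several arcs joining the same points, are allowed). For each arc $\gamma$ the inverse arc $-\gamma$, $(-\gamma)(s)=\gamma(1-s)$, also belongs to $\mathcal{E}$ and is regarded as distinct from $\gamma$; and $\gamma((0,1))\cap\gamma'([0,1])=\emptyset$ whenever $\gamma\ne\pm\gamma'$. $\mathbf{V}$ is the (finite) set of vertices, i.e. of initial and terminal points of arcs. $\Gamma$ is connected: any two vertices are linked by a finite concatenation of arcs. Hamiltonians: for each $\gamma\in\mathcal{E}$, $H_\gamma:[0,1]\times\mathbb{R}\to\mathbb{R}$ is continuous in $(s,p)$, coercive in $p$ ($H_\gamma(s,p)\to+\infty$ as $|p|\to\infty$, uniformly in $s$), and $H_{-\gamma}(s,p)=H_\gamma(1-s,-p)$. Moreover, for every $s\in[0,1]$, $H_\gamma(s,\cdot)$ is quasiconvex with $\mathrm{int}\{p:H_\gamma(s,p)\le a\}=\{p:H_\gamma(s,p)<a\}$ for all $a\in\mathbb{R}$, and $s\mapsto\min_{p}H_\gamma(s,p)$ is constant on $[0,1]$. Equations: for $\lambda\ge0$ let (E$_{\gamma,\lambda}$) be $\lambda w+H_\gamma(s,w')=0$ in $(0,1)$; sub/super/solutions are continuous functions on $[0,1]$ satisfying it in the viscosity sense in $(0,1)$. A continuous $w$ satisfies the state constraint boundary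 condition for (E$_{\gamma,\lambda}$) at $s=1$ if $\lambda\varphi(1)+H_\gamma(1,\varphi'(1))\ge0$ for every $C^1$ function $\varphi$ with $\varphi(1)=w(1)$ and $w\ge\varphi$ in $(1-\delta,1)$ for some $\delta>0$. A solution of the $0$-problem (Eikonal problem) on $\Gamma$ is a continuous $u:\Gamma\to\mathbb{R}$ such that $u\circ\gamma$ is a solution of (E$_{\gamma,0}$) for every $\gamma\in\mathcal{E}$ and, for every vertex $x$, there is at least one arc $\gamma$ with $\gamma(1)=x$ such that $u\circ\gamma$ satisfies the state constraint boundary condition for (E$_{\gamma,0}$) at $s=1$. There is exactly one $a\in\mathbb{R}$ (the critical value) for which the $0$-problem with every $H_\gamma$ replaced by $H_\gamma-a$ has a solution on $\Gamma$; it is assumed that the critical value is $a=0$. Graph and paths: $\mathbf{E}$ is an abstract set with a bijection $\Psi:\mathbf{E}\to\mathcal{E}$; for $e\in\mathbf{E}$ put $\mathrm{o}(e)=\Psi(e)(0)$, $-e=\Psi^{-1}(-\Psi(e))$, $\mathrm{t}(e)=\mathrm{o}(-e)=\Psi(e)(1)$. A path is a finite sequence $\xi=(e_i)_{i=1}^M$, $M\ge1$, of edges with $\mathrm{t}(e_j)=\mathrm{o}(e_{j+1})$; it joins $\mathrm{o}(e_1)$ to $\mathrm{t}(e_M)$, and is a cycle based on $y$ if $\mathrm{o}(e_1)=\mathrm{t}(e_M)=y$. For $\lambda>0$, $\alpha\in\mathbb{R}$, set $\rho_\lambda(\alpha,e)=\sup\{w(1): w$ subsolution of (E$_{\Psi(e),\lambda}$)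 with $w(0)\le\alpha\}$, and extend to paths by $\rho_\lambda(\alpha,(e_i)_{i=1}^M)=\rho_\lambda(\rho_\lambda(\alpha,(e_i)_{i=1}^{M-1}),e_M)$. For a cycle $\xi$, $\beta_\lambda(\xi)$ is the unique $\alpha\in\mathbb{R}$ with $\rho_\lambda(\alpha,\xi)=\alpha$. For each $\lambda>0$ the discrete equation has a unique solution $U_\lambda$, and the $\lambda$-Aubry set is $\mathcal{A}_\lambda=\{y\in\mathbf{V}: U_\lambda(y)=\beta_\lambda(\xi)\text{ for some cycle }\xi\text{ based on }y\}$. For $e\in\mathbf{E}$ let $\sigma(e)=v(1)$, where $v$ is the maximal subsolution of (E$_{\Psi(e),0}$) with $v(0)=0$, and $\sigma(\xi)=\sum_{i=1}^M\sigma(e_i)$ for a path $\xi=(e_i)_{i=1}^M$. *)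

theory Defs
  imports "HOL-Analysis.Analysis"
begin

section \<open>Networks\<close>

definition regular_curve :: "(real \<Rightarrow> 'a::real_normed_vector) \<Rightarrow> bool" where
  "regular_curve \<gamma> \<longleftrightarrow>
     (\<exists>D. continuous_on {0..1} D \<and>
          (\<forall>s\<in>{0..1}. (\<gamma> has_vector_derivative D s) (at s within {0..1}) \<and> D s \<noteq> 0))"

definition vertices :: "(real \<Rightarrow> 'a) set \<Rightarrow> 'a set" where
  "vertices \<A> = {\<gamma> 0 | \<gamma>. \<gamma> \<in> \<A>} \<union> {\<gamma> 1 | \<gamma>. \<gamma> \<in> \<A>}"

definition network_support :: "(real \<Rightarrow> 'a) set \<Rightarrow> 'a set" where
  "network_support \<A> = (\<Union>\<gamma>\<in>\<A>. \<gamma> ` {0..1})"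

text \<open>An edge \<open>e\<close> is realised by the curve \<open>\<Psi> e\<close>, so that its origin is \<open>\<Psi> e 0\<close> and its terminal
  point, the origin of the inverse edge, is \<open>\<Psi> e 1\<close>.\<close>

definition joins :: "'e set \<Rightarrow> ('e \<Rightarrow> real \<Rightarrow> 'a) \<Rightarrow> 'e list \<Rightarrow> 'a \<Rightarrow> 'a \<Rightarrow> bool" where
  "joins E \<Psi> \<xi> x y \<longleftrightarrow>
     \<xi> \<noteq> [] \<and> set \<xi> \<subseteq> E \<and> successively (\<lambda>e f. \<Psi> e 1 = \<Psi> f 0) \<xi> \<and>
     \<Psi> (hd \<xi>) 0 = x \<and> \<Psi> (last \<xi>) 1 = y"

text \<open>Arcs are functions with domain \<open>[0,1]\<close>; they are represented by total functions that are
  \<open>undefined\<close> off \<open>[0,1]\<close> (\<open>extensional\<close>), so that equality of arcs is equality as curves on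
  \<open>[0,1]\<close>. This representation is preserved by \<open>reversepath\<close>, since \<open>s \<mapsto> 1 - s\<close> maps the
  complement of \<open>[0,1]\<close> to itself. A simple arc never equals its own inverse. In the last clause the
  arcs themselves serve as edges.\<close>

definition network :: "(real \<Rightarrow> 'a::euclidean_space) set \<Rightarrow> bool" where
  "network \<A> \<longleftrightarrow>
     finite \<A> \<and> \<A> \<subseteq> extensional {0..1} \<and>
     (\<forall>\<gamma>\<in>\<A>. simple_path \<gamma> \<and> regular_curve \<gamma> \<and> reversepath \<gamma> \<in> \<A>) \<and>
     (\<forall>\<gamma>\<in>\<A>. \<forall>\<gamma>'\<in>\<A>. \<gamma> \<noteq> \<gamma>' \<and> \<gamma> \<noteq> reversepath \<gamma>' \<longrightarrow> \<gamma> ` {0<..<1} \<inter> \<gamma>' ` {0..1} = {}) \<and>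
     (\<forall>x\<in>vertices \<A>. \<forall>y\<in>vertices \<A>. \<exists>\<gamma>s. joins \<A> (\<lambda>\<gamma>. \<gamma>) \<gamma>s x y)"


section \<open>Hamiltonians\<close>

definition hamiltonian :: "(real \<Rightarrow> real \<Rightarrow> real) \<Rightarrow> bool" where
  "hamiltonian h \<longleftrightarrow>
     continuous_on ({0..1} \<times> UNIV) (\<lambda>(s, p). h s p) \<and>
     (\<forall>M. \<exists>R. \<forall>s\<in>{0..1}. \<forall>p. \<bar>p\<bar> \<ge> R \<longrightarrow> h s p \<ge> M) \<and>
     (\<forall>s\<in>{0..1}. \<forall>a. convex {p. h s p \<le> a} \<and> interior {p. h s p \<le> a} = {p. h s p < a}) \<and>
     (\<exists>c. \<forall>s\<in>{0..1}. (\<exists>p. h s p = c) \<and> (\<forall>p. c \<le> h s p))"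

definition network_hamiltonian ::
  "(real \<Rightarrow> 'a::euclidean_space) set \<Rightarrow> ((real \<Rightarrow> 'a) \<Rightarrow> real \<Rightarrow> real \<Rightarrow> real) \<Rightarrow> bool" where
  "network_hamiltonian \<A> H \<longleftrightarrow>
     (\<forall>\<gamma>\<in>\<A>. hamiltonian (H \<gamma>) \<and> (\<forall>s\<in>{0..1}. \<forall>p. H (reversepath \<gamma>) s p = H \<gamma> (1 - s) (- p)))"


section \<open>Viscosity solutions on an arc\<close>

text \<open>These are notions for \<open>\<lambda> w + h(s, w') = 0\<close> in \<open>(0,1)\<close>. Only the values of \<open>w\<close> on \<open>[0,1]\<close> matter.
  Test functions are taken \<open>C\<^sup>1\<close> on the whole line, which is no restriction since only their behaviour
  near the contact point (one-sided at \<open>s = 1\<close>) is used.\<close>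

definition subsol :: "real \<Rightarrow> (real \<Rightarrow> real \<Rightarrow> real) \<Rightarrow> (real \<Rightarrow> real) \<Rightarrow> bool" where
  "subsol l h w \<longleftrightarrow>
     continuous_on {0..1} w \<and>
     (\<forall>s\<in>{0<..<1}. \<forall>\<phi>. \<phi> C1_differentiable_on UNIV \<and> \<phi> s = w s \<and> (\<forall>\<^sub>F t in at s. w t \<le> \<phi> t) \<longrightarrow>
        l * \<phi> s + h s (deriv \<phi> s) \<le> 0)"

definition supersol :: "real \<Rightarrow> (real \<Rightarrow> real \<Rightarrow> real) \<Rightarrow> (real \<Rightarrow> real) \<Rightarrow> bool" where
  "supersol l h w \<longleftrightarrow>
     continuous_on {0..1} w \<and>
     (\<forall>s\<in>{0<..<1}. \<forall>\<phi>. \<phi> C1_differentiable_on UNIV \<and> \<phi> s = w s \<and> (\<forall>\<^sub>F t in at s. \<phi> t \<le> w t) \<longrightarrow>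
        l * \<phi> s + h s (deriv \<phi> s) \<ge> 0)"

definition state_constraint :: "real \<Rightarrow> (real \<Rightarrow> real \<Rightarrow> real) \<Rightarrow> (real \<Rightarrow> real) \<Rightarrow> bool" where
  "state_constraint l h w \<longleftrightarrow>
     (\<forall>\<phi>. \<phi> C1_differentiable_on UNIV \<and> \<phi> 1 = w 1 \<and>
          (\<exists>\<delta>>0. \<forall>t\<in>{1 - \<delta><..<1}. \<phi> t \<le> w t) \<longrightarrow>
        l * \<phi> 1 + h 1 (deriv \<phi> 1) \<ge> 0)"


section \<open>The Eikonal problem and the critical value\<close>

definition eikonal_solution ::
  "(real \<Rightarrow> 'a::euclidean_space) set \<Rightarrow> ((real \<Rightarrow> 'a) \<Rightarrow> real \<Rightarrow> real \<Rightarrow> real) \<Rightarrow> ('a \<Rightarrow> real) \<Rightarrow> bool" where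
  "eikonal_solution \<A> H u \<longleftrightarrow>
     continuous_on (network_support \<A>) u \<and>
     (\<forall>\<gamma>\<in>\<A>. subsol 0 (H \<gamma>) (u \<circ> \<gamma>) \<and> supersol 0 (H \<gamma>) (u \<circ> \<gamma>)) \<and>
     (\<forall>x\<in>vertices \<A>. \<exists>\<gamma>\<in>\<A>. \<gamma> 1 = x \<and> state_constraint 0 (H \<gamma>) (u \<circ> \<gamma>))"

text \<open>At most one \<open>a\<close> has this property on a nonempty network; that is a result of the theory and is
  not part of the definition.\<close>

definition critical_value ::
  "(real \<Rightarrow> 'a::euclidean_space) set \<Rightarrow> ((real \<Rightarrow> 'a) \<Rightarrow> real \<Rightarrow> real \<Rightarrow> real) \<Rightarrow> real \<Rightarrow> bool" where
  "critical_value \<A> H a \<longleftrightarrow> (\<exists>u. eikonal_solution \<A> (\<lambda>\<gamma> s p. H \<gamma> s p - a) u)"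


section \<open>The discrete problem\<close>

text \<open>From here on \<open>h e\<close> is the Hamiltonian attached to the edge \<open>e\<close>, that is \<open>H (\<Psi> e)\<close>.\<close>

definition rho :: "('e \<Rightarrow> real \<Rightarrow> real \<Rightarrow> real) \<Rightarrow> real \<Rightarrow> real \<Rightarrow> 'e \<Rightarrow> real" where
  "rho h l \<alpha> e = Sup {w 1 | w. subsol l (h e) w \<and> w 0 \<le> \<alpha>}"

definition rho_path :: "('e \<Rightarrow> real \<Rightarrow> real \<Rightarrow> real) \<Rightarrow> real \<Rightarrow> real \<Rightarrow> 'e list \<Rightarrow> real" where
  "rho_path h l \<alpha> \<xi> = foldl (rho h l) \<alpha> \<xi>"

definition beta :: "('e \<Rightarrow> real \<Rightarrow> real \<Rightarrow> real) \<Rightarrow> real \<Rightarrow> 'e list \<Rightarrow> real" where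
  "beta h l \<xi> = (THE \<alpha>. rho_path h l \<alpha> \<xi> = \<alpha>)"

definition sigma :: "('e \<Rightarrow> real \<Rightarrow> real \<Rightarrow> real) \<Rightarrow> 'e \<Rightarrow> real" where
  "sigma h e = (THE r. \<exists>v. subsol 0 (h e) v \<and> v 0 = 0 \<and> v 1 = r \<and>
                  (\<forall>w. subsol 0 (h e) w \<and> w 0 = 0 \<longrightarrow> (\<forall>s\<in>{0..1}. w s \<le> v s)))"

definition sigma_path :: "('e \<Rightarrow> real \<Rightarrow> real \<Rightarrow> real) \<Rightarrow> 'e list \<Rightarrow> real" where
  "sigma_path h \<xi> = (\<Sum>e\<leftarrow>\<xi>. sigma h e)"

text \<open>The equation \<open>W(x) = min {F(W(o(e)), e) | t(e) = x}\<close> on a set \<open>X\<close> of vertices.\<close>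

definition discrete_solution ::
  "'a set \<Rightarrow> 'e set \<Rightarrow> ('e \<Rightarrow> real \<Rightarrow> 'a) \<Rightarrow> (real \<Rightarrow> 'e \<Rightarrow> real) \<Rightarrow> ('a \<Rightarrow> real) \<Rightarrow> bool" where
  "discrete_solution X E \<Psi> F W \<longleftrightarrow>
     (\<forall>x\<in>X. W x = Min ((\<lambda>e. F (W (\<Psi> e 0)) e) ` {e\<in>E. \<Psi> e 1 = x}))"

text \<open>\<open>U l\<close> stands for the solution of the discrete equation with discount factor \<open>l\<close>.\<close>

definition aubry ::
  "'a set \<Rightarrow> 'e set \<Rightarrow> ('e \<Rightarrow> real \<Rightarrow> 'a) \<Rightarrow> ('e \<Rightarrow> real \<Rightarrow> real \<Rightarrow> real) \<Rightarrow> (real \<Rightarrow> 'a \<Rightarrow> real) \<Rightarrow>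
   real \<Rightarrow> 'a set" where
  "aubry X E \<Psi> h U l = {y\<in>X. \<exists>\<xi>. joins E \<Psi> \<xi> y y \<and> U l y = beta h l \<xi>}"

definition limit_aubry ::
  "'a set \<Rightarrow> 'e set \<Rightarrow> ('e \<Rightarrow> real \<Rightarrow> 'a) \<Rightarrow> ('e \<Rightarrow> real \<Rightarrow> real \<Rightarrow> real) \<Rightarrow> (real \<Rightarrow> 'a \<Rightarrow> real) \<Rightarrow>
   'a set" where
  "limit_aubry X E \<Psi> h U =
     {y\<in>X. \<exists>\<mu>::nat \<Rightarrow> real. (\<forall>n. \<mu> n > 0) \<and> \<mu> \<longlonglongrightarrow> 0 \<and> (\<forall>n. y \<in> aubry X E \<Psi> h U (\<mu> n))}"

definition is_minimum :: "real set \<Rightarrow> real \<Rightarrow> bool" where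
  "is_minimum S m \<longleftrightarrow> m \<in> S \<and> (\<forall>z\<in>S. m \<le> z)"

end

theory Submission
  imports Defs
begin

text \<open>On one arc the maximal Eikonal subsolution with \<open>v 0 = 0\<close> is the primitive \<open>Q\<close> of the maximal slope
  \<open>q s = max {p. k s p \<le> 0}\<close>, which is continuous in \<open>s\<close> (\<open>maximal_slope_exists\<close>); so \<open>\<sigma> = Q 1\<close>. A
  comparison principle for subsolutions and primitives (\<open>subsol_increment_le\<close>) replaces any discussion
  of almost everywhere differentiability.

  For \<open>\<lambda> > 0\<close> the map \<open>\<alpha> \<mapsto> \<rho>\<^sub>\<lambda>(\<alpha>, e)\<close> is nondecreasing and strictly contracting
  (\<open>rho_strict_contraction\<close>). Hence a value reproduced along a cycle is the only fixed point of
  that cycle and equals its \<open>\<beta>\<^sub>\<lambda>\<close>.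

  The main analytic step (\<open>rho_tendsto\<close>) is that \<open>\<rho>\<^sub>\<lambda>(U\<^sub>\<lambda>(o(e)), e)\<close> tends to \<open>V(o(e)) + \<sigma>(e)\<close> along
  the given sequence. The upper bound holds because competitors can be assumed bounded
  below uniformly in \<open>\<lambda>\<close>, so that \<open>\<lambda> w\<close> is small from below. For the lower bound, if the minimum of the
  Hamiltonian on the arc is negative, then \<open>Q\<close> can be lowered slightly to gain room for \<open>\<lambda> w\<close>. If the minimum
  is \<open>0\<close>, subsolutions must be nonpositive, and \<open>V(o(e)) + Q\<close> is admissible only if it is
  nonpositive too. This follows from the discrete equation at \<open>o(e)\<close>, applied to the reversed arc, on which
  the maximal subsolution retraces \<open>Q\<close> (\<open>limit_nonpositive_along_arc\<close>).

  The rest is finite combinatorics. For each \<open>\<lambda>\<^sub>n\<close> choose an edge realising the minimum at each vertex. One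
  choice recurs for infinitely many \<open>n\<close>, and along this subsequence the limit equation holds with equality
  on the chosen edges. Following them backwards from \<open>x\<close> leads to a cycle
  (\<open>selected_edges_reach_cycle\<close>), whose vertices are in the \<open>\<lambda>\<^sub>n\<close>-Aubry sets of the whole subsequence, and
  the path from the cycle to \<open>x\<close> attains the minimum in the representation formula.\<close>

section \<open>Test functions and comparison with primitives\<close>

lemma C1_differentiable_on_UNIV_I:
  assumes "\<And>t. (f has_real_derivative D t) (at t)" "continuous_on UNIV D"
  shows "f C1_differentiable_on UNIV"
  unfolding C1_differentiable_on_def
  using assms by (auto simp: has_real_derivative_iff_has_vector_derivative)

lemma C1_differentiable_on_UNIV_D:
  fixes f :: "real \<Rightarrow> real"
  assumes "f C1_differentiable_on UNIV"
  shows "(f has_real_derivative deriv f t) (at t)" "continuous_on UNIV (deriv f)"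
proof -
  obtain D where D: "\<And>t. (f has_real_derivative D t) (at t)" "continuous_on UNIV D"
    using assms unfolding C1_differentiable_on_def
    by (auto simp: has_real_derivative_iff_has_vector_derivative)
  moreover have "deriv f = D" using D(1) by (auto intro: DERIV_imp_deriv)
  ultimately show "(f has_real_derivative deriv f t) (at t)" "continuous_on UNIV (deriv f)" by auto
qed

lemma subsolD:
  assumes "subsol l h w" "s \<in> {0<..<1}" "\<phi> C1_differentiable_on UNIV" "\<phi> s = w s"
    "\<forall>\<^sub>F t in at s. w t \<le> \<phi> t"
  shows "l * w s + h s (deriv \<phi> s) \<le> 0"
  using assms unfolding subsol_def by metis

text \<open>If \<open>w - \<psi>\<close> is larger at an inner point than at both ends, it has an inner maximum, and there a
  vertical translate of \<open>\<psi>\<close> is an admissible test function.\<close>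

lemma subsol_inner_maximum:
  assumes sub: "subsol l h w" and ab: "0 \<le> a" "a < m" "m < b" "b \<le> 1"
    and d\<psi>: "\<And>t. (\<psi> has_real_derivative D t) (at t)" and cD: "continuous_on UNIV D"
    and less: "w a - \<psi> a < w m - \<psi> m" "w b - \<psi> b < w m - \<psi> m"
  shows "\<exists>s\<in>{a<..<b}. l * w s + h s (D s) \<le> 0"
proof -
  have "continuous_on UNIV \<psi>"
    using d\<psi> by (meson DERIV_isCont continuous_at_imp_continuous_on)
  then have "continuous_on {a..b} (\<lambda>t. w t - \<psi> t)"
    using sub ab unfolding subsol_def
    by (intro continuous_intros) (auto elim: continuous_on_subset)
  then obtain s where s: "s \<in> {a..b}" and smax: "\<And>t. t \<in> {a..b} \<Longrightarrow> w t - \<psi> t \<le> w s - \<psi> s"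
    using continuous_attains_sup[of "{a..b}" "\<lambda>t. w t - \<psi> t"] ab by auto
  have "w m - \<psi> m \<le> w s - \<psi> s" using smax ab by auto
  then have "s \<noteq> a" "s \<noteq> b" using less by auto
  then have s': "s \<in> {a<..<b}" using s by auto
  define \<phi> where "\<phi> t = \<psi> t + (w s - \<psi> s)" for t
  have d\<phi>: "(\<phi> has_real_derivative D t) (at t)" for t
    unfolding \<phi>_def using d\<psi> by (auto intro!: derivative_eq_intros)
  have "\<forall>\<^sub>F t in at s. t \<in> {a<..<b}"
    using s' by (intro eventually_at_in_open') auto
  then have "\<forall>\<^sub>F t in at s. w t \<le> \<phi> t"
  proof eventually_elim
    case (elim t)
    then show ?case using smax[of t] by (simp add: \<phi>_def)
  qed
  moreover have "\<phi> C1_differentiable_on UNIV" "\<phi> s = w s" "deriv \<phi> s = D s"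
    using C1_differentiable_on_UNIV_I[OF d\<phi> cD] DERIV_imp_deriv[OF d\<phi>] by (auto simp: \<phi>_def)
  moreover have "s \<in> {0<..<1}" using s' ab by auto
  ultimately have "l * w s + h s (D s) \<le> 0"
    using subsolD[OF sub] by metis
  then show ?thesis using s' by auto
qed

text \<open>A sufficiently steep parabola with vertex in the middle of \<open>(a, b)\<close> touches the subsolution inside
  this interval.\<close>

lemma subsol_touched_densely:
  assumes "subsol l h w" "0 \<le> a" "a < b" "b \<le> 1"
  shows "\<exists>s\<in>{a<..<b}. \<exists>p. l * w s + h s p \<le> 0"
proof -
  define m where "m = (a + b) / 2"
  define K where "K = (\<bar>w a\<bar> + \<bar>w b\<bar> + \<bar>w m\<bar> + 1) / ((b - a) / 2)\<^sup>2"
  have K: "K * ((b - a) / 2)\<^sup>2 = \<bar>w a\<bar> + \<bar>w b\<bar> + \<bar>w m\<bar> + 1"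
    unfolding K_def using assms by simp
  have "a - m = - ((b - a) / 2)" "b - m = (b - a) / 2" unfolding m_def by (auto simp: field_simps)
  then have "K * (a - m)\<^sup>2 = \<bar>w a\<bar> + \<bar>w b\<bar> + \<bar>w m\<bar> + 1" "K * (b - m)\<^sup>2 = \<bar>w a\<bar> + \<bar>w b\<bar> + \<bar>w m\<bar> + 1"
    using K by (simp_all only: power2_minus)
  then have "w a - K * (a - m)\<^sup>2 < w m - K * (m - m)\<^sup>2" "w b - K * (b - m)\<^sup>2 < w m - K * (m - m)\<^sup>2"
    by auto
  moreover have "a < m" "m < b" using assms by (auto simp: m_def)
  moreover have d: "((\<lambda>t. K * (t - m)\<^sup>2) has_real_derivative 2 * K * (t - m)) (at t)" for t
    by (auto intro!: derivative_eq_intros simp: algebra_simps)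
  moreover have c: "continuous_on UNIV (\<lambda>t. 2 * K * (t - m))" by (intro continuous_intros)
  ultimately show ?thesis
    using subsol_inner_maximum[OF assms(1,2) _ _ assms(4) d c] by blast
qed

text \<open>A subsolution grows at most as fast as a primitive \<open>G\<close> of a continuous bound \<open>g\<close> for the slopes of its
  test functions. Otherwise \<open>w - G\<close> would increase from \<open>a\<close> to \<open>b\<close>; the subtracted function \<open>\<psi>\<close> has
  positive slope, is small at \<open>b\<close> and large at a point \<open>c > b\<close>, so that the resulting inner
  maximum yields a test slope exceeding \<open>g\<close>.\<close>

lemma subsol_increment_le:
  assumes sub: "subsol l h w"
    and dG: "\<And>t. (G has_real_derivative g t) (at t)" and cg: "continuous_on UNIV g"
    and slope: "\<And>s p. s \<in> {0<..<1} \<Longrightarrow> l * w s + h s p \<le> 0 \<Longrightarrow> p \<le> g s"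
    and ab: "0 \<le> a" "a \<le> b" "b \<le> 1"
  shows "w b - w a \<le> G b - G a"
proof -
  define f where "f t = w t - G t" for t
  have cf: "continuous_on {0..1} f"
  proof -
    have "continuous_on {0..1} G"
      using dG by (meson DERIV_isCont continuous_at_imp_continuous_on)
    then show ?thesis
      unfolding f_def using sub by (auto simp: subsol_def intro: continuous_on_diff)
  qed
  have open_case: "f b \<le> f a" if ab: "0 \<le> a" "a < b" "b < 1" for a b
  proof (rule ccontr)
    assume "\<not> f b \<le> f a"
    define D where "D = f b - f a"
    have D: "D > 0" using \<open>\<not> f b \<le> f a\<close> by (simp add: D_def)
    obtain c where c: "b < c" "c < 1" using ab dense by blast
    define \<kappa> where "\<kappa> = 1 / (c - a)"
    have \<kappa>: "\<kappa> > 0" "(c - a) * \<kappa> = 1" using ab c by (auto simp: \<kappa>_def)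
    define r where "r = (b - a) * \<kappa>"
    have r: "0 < r" "r < 1" using ab c by (auto simp: r_def \<kappa>_def)
    define M where "M = \<bar>f c - f a\<bar> + 1"
    have "(\<lambda>n. M * r ^ n) \<longlonglongrightarrow> M * 0"
      by (intro tendsto_intros LIMSEQ_power_zero) (use r in auto)
    then have "\<forall>\<^sub>F n in sequentially. M * r ^ n < D / 3"
      by (rule order_tendstoD) (use D in auto)
    then obtain N where "\<And>n. n \<ge> N \<Longrightarrow> M * r ^ n < D / 3"
      unfolding eventually_sequentially by blast
    then obtain n where n: "M * r ^ n < D / 3" "n \<ge> 1"
      using max.cobounded1[of N 1] max.cobounded2[of 1 N] by blast
    define \<epsilon> where "\<epsilon> = D / (3 * (b - a))"
    have \<epsilon>: "\<epsilon> > 0" "\<epsilon> * (b - a) = D / 3"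
      using D ab by (auto simp: \<epsilon>_def divide_simps)
    define \<psi> where "\<psi> t = \<epsilon> * (t - a) + M * ((t - a) * \<kappa>) ^ n" for t
    define \<psi>' where "\<psi>' t = \<epsilon> + M * (real n * ((t - a) * \<kappa>) ^ (n - 1) * \<kappa>)" for t
    have d: "((\<lambda>t. G t + \<psi> t) has_real_derivative g t + \<psi>' t) (at t)" for t
      unfolding \<psi>_def \<psi>'_def 
      by (rule derivative_eq_intros dG refl)+ simp
    have cont: "continuous_on UNIV (\<lambda>t. g t + \<psi>' t)"
      unfolding \<psi>'_def using cg by (intro continuous_intros) auto
    have "\<psi> a = 0" using n by (auto simp: \<psi>_def power_0_left)
    moreover have "\<psi> b < 2 * D / 3" using n \<epsilon> by (auto simp: \<psi>_def r_def)
    moreover have "\<psi> c > f c - f a"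
    proof -
      have "\<epsilon> * (c - a) > 0" using \<epsilon> c ab by simp
      then show ?thesis by (simp add: \<psi>_def \<kappa> M_def)
    qed
    ultimately have "w a - (G a + \<psi> a) < w b - (G b + \<psi> b)" "w c - (G c + \<psi> c) < w b - (G b + \<psi> b)"
      using D unfolding D_def f_def by auto
    then obtain s where s: "s \<in> {a<..<c}" "l * w s + h s (g s + \<psi>' s) \<le> 0"
      using subsol_inner_maximum[OF sub _ _ _ _ d cont, of a b c] ab c by auto
    have "g s + \<psi>' s \<le> g s" using s ab c by (intro slope) auto
    moreover have "\<psi>' s > 0"
      unfolding \<psi>'_def using \<epsilon> s \<kappa>
      by (intro add_pos_nonneg mult_nonneg_nonneg zero_le_power) (auto simp: M_def)
    ultimately show False by simp
  qed
  have "f b \<le> f a"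
  proof (cases "a = b")
    case False
    then have "a < b" using ab by simp
    show ?thesis
    proof (cases "b = 1")
      case True
      have cl: "closure {a<..<1} = {a..1}" using \<open>a < b\<close> True by simp
      have "continuous_on {a..1} f" using cf by (rule continuous_on_subset) (use ab in auto)
      then show ?thesis
        using continuous_le_on_closure[of "{a<..<1}" f b "f a"] open_case ab \<open>a < b\<close> True
        unfolding cl by auto
    qed (use open_case ab \<open>a < b\<close> in auto)
  qed auto
  then show ?thesis by (simp add: f_def)
qed

text \<open>At a point of differentiability every test function has the slope of \<open>w\<close>, because \<open>\<phi> - w\<close> has a
  local minimum there.\<close>

lemma subsolI_differentiable:
  assumes cw: "continuous_on {0..1} w"
    and d: "\<And>s. s \<in> {0<..<1} \<Longrightarrow> (w has_real_derivative D s) (at s)"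
    and le: "\<And>s. s \<in> {0<..<1} \<Longrightarrow> l * w s + h s (D s) \<le> 0"
  shows "subsol l h w"
  unfolding subsol_def
proof (intro conjI cw ballI allI impI)
  fix s :: real and \<phi> :: "real \<Rightarrow> real"
  assume s: "s \<in> {0<..<1}"
    and "\<phi> C1_differentiable_on UNIV \<and> \<phi> s = w s \<and> (\<forall>\<^sub>F t in at s. w t \<le> \<phi> t)"
  then have \<phi>: "(\<phi> has_real_derivative deriv \<phi> s) (at s)" "\<phi> s = w s" "\<forall>\<^sub>F t in at s. w t \<le> \<phi> t"
    using C1_differentiable_on_UNIV_D by auto
  have "((\<lambda>t. \<phi> t - w t) has_real_derivative deriv \<phi> s - D s) (at s)"
    using \<phi>(1) d[OF s] by (rule DERIV_diff)
  moreover obtain e where "e > 0" "\<And>t. t \<noteq> s \<Longrightarrow> dist t s < e \<Longrightarrow> w t \<le> \<phi> t"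
    using \<phi>(3) unfolding eventually_at by auto
  then have "\<phi> s - w s \<le> \<phi> t - w t" if "\<bar>s - t\<bar> < e" for t
    using \<phi>(2) that by (cases "t = s") (auto simp: dist_real_def abs_minus_commute)
  ultimately have "deriv \<phi> s - D s = 0"
    using DERIV_local_min[of "\<lambda>t. \<phi> t - w t"] \<open>e > 0\<close> by blast
  then show "l * \<phi> s + h s (deriv \<phi> s) \<le> 0"
    using le[OF s] \<phi>(2) by simp
qed

lemma subsol_max:
  assumes "subsol l h w1" "subsol l h w2"
  shows "subsol l h (\<lambda>t. max (w1 t) (w2 t))"
  unfolding subsol_def
proof (intro conjI ballI allI impI)
  show "continuous_on {0..1} (\<lambda>t. max (w1 t) (w2 t))"
    using assms by (auto simp: subsol_def intro: continuous_on_max)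
  fix s :: real and \<phi> :: "real \<Rightarrow> real"
  assume s: "s \<in> {0<..<1}" and \<phi>: "\<phi> C1_differentiable_on UNIV \<and> \<phi> s = max (w1 s) (w2 s) \<and>
    (\<forall>\<^sub>F t in at s. max (w1 t) (w2 t) \<le> \<phi> t)"
  then have "\<forall>\<^sub>F t in at s. w1 t \<le> \<phi> t" "\<forall>\<^sub>F t in at s. w2 t \<le> \<phi> t"
    by (auto elim: eventually_mono)
  moreover have "\<phi> s = w1 s \<or> \<phi> s = w2 s" using \<phi> by auto
  ultimately show "l * \<phi> s + h s (deriv \<phi> s) \<le> 0"
    using subsolD[OF assms(1) s, of \<phi>] subsolD[OF assms(2) s, of \<phi>] \<phi> by auto
qed

text \<open>Test functions for \<open>w + \<epsilon> t - k\<close> are those for \<open>w\<close>, tilted in the same way.\<close>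

lemma subsol_tilt:
  assumes sub: "subsol l h w"
    and le: "\<And>s p. s \<in> {0<..<1} \<Longrightarrow> l * w s + h s p \<le> 0 \<Longrightarrow>
      l * (w s + \<epsilon> * s - k) + h' s (p + \<epsilon>) \<le> 0"
  shows "subsol l h' (\<lambda>t. w t + \<epsilon> * t - k)"
  unfolding subsol_def
proof (intro conjI ballI allI impI)
  show "continuous_on {0..1} (\<lambda>t. w t + \<epsilon> * t - k)"
    using sub by (auto simp: subsol_def intro!: continuous_intros)
  fix s :: real and \<phi> :: "real \<Rightarrow> real"
  assume s: "s \<in> {0<..<1}" and \<phi>: "\<phi> C1_differentiable_on UNIV \<and> \<phi> s = w s + \<epsilon> * s - k \<and>
    (\<forall>\<^sub>F t in at s. w t + \<epsilon> * t - k \<le> \<phi> t)"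
  define \<eta> where "\<eta> t = \<phi> t - \<epsilon> * t + k" for t
  have d: "(\<eta> has_real_derivative deriv \<phi> t - \<epsilon>) (at t)" for t
    unfolding \<eta>_def using C1_differentiable_on_UNIV_D(1) \<phi>
    by (auto intro!: derivative_eq_intros)
  have "\<eta> C1_differentiable_on UNIV"
    using C1_differentiable_on_UNIV_D(2) \<phi>
    by (intro C1_differentiable_on_UNIV_I[OF d] continuous_intros) auto
  moreover have "\<eta> s = w s" using \<phi> by (simp add: \<eta>_def)
  moreover have "\<forall>\<^sub>F t in at s. w t \<le> \<eta> t"
    unfolding \<eta>_def using \<phi> by (simp add: algebra_simps)
  ultimately have "l * w s + h s (deriv \<phi> s - \<epsilon>) \<le> 0"
    using subsolD[OF sub s, of \<eta>] DERIV_imp_deriv[OF d, of s] by simp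
  then show "l * \<phi> s + h' s (deriv \<phi> s) \<le> 0"
    using le[OF s, of "deriv \<phi> s - \<epsilon>"] \<phi> by simp
qed

section \<open>The maximal slope of the Eikonal equation\<close>

lemma hamiltonian_continuous_on_compose:
  assumes "hamiltonian k" "continuous_on S f" "continuous_on S g" "f ` S \<subseteq> {0..1}"
  shows "continuous_on S (\<lambda>x. k (f x) (g x))"
proof -
  have "continuous_on S ((\<lambda>(s, p). k s p) \<circ> (\<lambda>x. (f x, g x)))"
    using assms unfolding hamiltonian_def
    by (intro continuous_on_compose continuous_on_Pair)
      (auto elim!: continuous_on_subset)
  then show ?thesis by (simp add: o_def)
qed

lemma hamiltonian_tendsto:
  assumes "hamiltonian k" "f \<longlonglongrightarrow> s" "g \<longlonglongrightarrow> p" "\<And>n. f n \<in> {0..1}" "s \<in> {0..1}"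
  shows "(\<lambda>n. k (f n) (g n)) \<longlonglongrightarrow> k s p"
proof -
  have "continuous_on ({0..1} \<times> UNIV) (\<lambda>(s, p). k s p)"
    using assms(1) by (simp add: hamiltonian_def)
  moreover have "(\<lambda>n. (f n, g n)) \<longlonglongrightarrow> (s, p)" using assms by (intro tendsto_Pair)
  ultimately have "(\<lambda>n. (\<lambda>(s, p). k s p) (f n, g n)) \<longlonglongrightarrow> (\<lambda>(s, p). k s p) (s, p)"
    by (rule continuous_on_tendsto_compose) (use assms in auto)
  then show ?thesis by simp
qed

lemma hamiltonian_sublevel_interval:
  assumes "hamiltonian k" "s \<in> {0..1}" "k s p \<le> a" "k s r \<le> a" "p \<le> x" "x \<le> r"
  shows "k s x \<le> a"
proof -
  have "convex {p. k s p \<le> a}" using assms by (simp add: hamiltonian_def)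
  then have "x \<in> {p. k s p \<le> a}"
    using assms mem_is_interval_1_I is_interval_convex_1 by (metis mem_Collect_eq)
  then show ?thesis by simp
qed

lemma hamiltonian_shift:
  assumes "hamiltonian k"
  shows "hamiltonian (\<lambda>s p. k s p - d)"
proof -
  have "{p. k s p - d \<le> a} = {p. k s p \<le> a + d}" "{p. k s p - d < a} = {p. k s p < a + d}" for s a
    by auto
  moreover have "continuous_on ({0..1} \<times> UNIV) (\<lambda>(s, p). k s p - d)"
    using assms unfolding hamiltonian_def case_prod_unfold by (auto intro: continuous_on_diff)
  moreover have "\<exists>R. \<forall>s\<in>{0..1}. \<forall>p. R \<le> \<bar>p\<bar> \<longrightarrow> M \<le> k s p - d" for M
  proof -
    obtain R where "\<forall>s\<in>{0..1}. \<forall>p. R \<le> \<bar>p\<bar> \<longrightarrow> M + d \<le> k s p"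
      using assms unfolding hamiltonian_def by meson
    then show ?thesis by (intro exI[of _ R]) (simp add: le_diff_eq)
  qed
  moreover have "\<exists>c. \<forall>s\<in>{0..1}. (\<exists>p. k s p - d = c) \<and> (\<forall>p. c \<le> k s p - d)"
  proof -
    obtain c where "\<forall>s\<in>{0..1}. (\<exists>p. k s p = c) \<and> (\<forall>p. c \<le> k s p)"
      using assms unfolding hamiltonian_def by meson
    then show ?thesis by (intro exI[of _ "c - d"]) simp
  qed
  ultimately show ?thesis
    using assms unfolding hamiltonian_def by simp
qed

text \<open>The condition on the interior of the sublevel sets excludes plateaus, both above the minimum and, when
  \<open>a\<close> is the minimum itself, at the bottom; in the latter case the hypotheses contradict each other.\<close>

lemma hamiltonian_less_inside:
  assumes "hamiltonian k" "s \<in> {0..1}" "k s p \<le> a" "k s r \<le> a" "p < x" "x < r"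
  shows "k s x < a"
proof -
  have "{p<..<r} \<subseteq> {p. k s p \<le> a}"
    using hamiltonian_sublevel_interval[OF assms(1-4)] by auto
  then have "x \<in> interior {p. k s p \<le> a}"
    using assms by (intro interiorI[of "{p<..<r}"]) auto
  also have "\<dots> = {p. k s p < a}" using assms by (simp add: hamiltonian_def)
  finally show ?thesis by simp
qed

text \<open>Beyond the maximal slope \<open>k s\<close> is positive; approach it from the right.\<close>

lemma hamiltonian_nonneg_at_maximal_slope:
  assumes ham: "hamiltonian k" and s: "s \<in> {0..1}" and upper: "\<And>p. k s p \<le> 0 \<Longrightarrow> p \<le> r"
  shows "0 \<le> k s r"
proof -
  have "(\<lambda>n. k s (r + 1 / real (Suc n))) \<longlonglongrightarrow> k s (r + 0)"
    using s by (intro hamiltonian_tendsto[OF ham] tendsto_intros LIMSEQ_Suc[OF lim_1_over_n]) auto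
  moreover have "0 \<le> k s (r + 1 / real (Suc n))" for n
  proof (rule ccontr)
    assume "\<not> 0 \<le> k s (r + 1 / real (Suc n))"
    then have "r + 1 / real (Suc n) \<le> r" by (intro upper) linarith
    moreover have "1 / real (Suc n) > 0" by simp
    ultimately show False by linarith
  qed
  ultimately have "0 \<le> k s (r + 0)" by (intro LIMSEQ_le_const[where X = "\<lambda>n. k s (r + 1 / real (Suc n))"]) auto
  then show ?thesis by simp
qed

text \<open>A single point of contact with a test function bounds the minimum, which is constant along the arc.\<close>

lemma hamiltonian_minimum_nonpos:
  assumes ham: "hamiltonian k" and sub: "subsol 0 k w" and s: "s \<in> {0..1}"
  shows "\<exists>p. k s p \<le> 0"
proof -
  obtain c where c: "\<And>s. s \<in> {0..1} \<Longrightarrow> (\<exists>p. k s p = c) \<and> (\<forall>p. c \<le> k s p)"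
    using ham unfolding hamiltonian_def by metis
  obtain t p where t: "t \<in> {0<..<1}" "k t p \<le> 0"
    using subsol_touched_densely[OF sub, of 0 1] by auto
  then have "c \<le> k t p" using c[of t] by auto
  moreover obtain r where "k s r = c" using c[OF s] by blast
  ultimately show ?thesis using t(2) by (intro exI[of _ r]) simp
qed

text \<open>The maximal slope \<open>q s = max {p. k s p \<le> 0}\<close> depends continuously on \<open>s\<close>: its graph is closed,
  because a limit point \<open>p < q s\<close> of the graph would make \<open>k s\<close> nonnegative on \<open>(p, q s)\<close>, where it is
  negative by the absence of plateaus.\<close>

lemma maximal_slope_exists:
  assumes ham: "hamiltonian k" and ne: "\<And>s. s \<in> {0..1} \<Longrightarrow> \<exists>p. k s p \<le> 0"
  shows "\<exists>q. continuous_on {0..1} q \<and> (\<forall>s\<in>{0..1}. k s (q s) \<le> 0 \<and> (\<forall>p. k s p \<le> 0 \<longrightarrow> p \<le> q s))"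
proof -
  obtain R where R: "\<And>s p. s \<in> {0..1} \<Longrightarrow> R \<le> \<bar>p\<bar> \<Longrightarrow> k s p \<ge> 1"
    using ham unfolding hamiltonian_def by meson
  have bound: "\<bar>p\<bar> \<le> R" if "s \<in> {0..1}" "k s p \<le> 0" for s p
    using R[OF that(1), of p] that(2) by linarith
  define q where "q s = Sup {p. k s p \<le> 0}" for s
  have bdd: "bdd_above {p. k s p \<le> 0}" if "s \<in> {0..1}" for s
    using bound[OF that] by (intro bdd_aboveI[of _ R]) (auto simp: abs_le_iff)
  have upper: "p \<le> q s" if "s \<in> {0..1}" "k s p \<le> 0" for s p
    unfolding q_def using that bdd by (auto intro: cSup_upper)
  have attained: "k s (q s) \<le> 0" if s: "s \<in> {0..1}" for s
  proof -
    have "closed {p. k s p \<le> 0}"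
      by (intro closed_Collect_le hamiltonian_continuous_on_compose[OF ham] continuous_intros)
        (use s in auto)
    then show ?thesis
      using closed_contains_Sup[OF _ bdd[OF s]] ne[OF s] unfolding q_def by auto
  qed
  have zero: "k s (q s) = 0" if s: "s \<in> {0..1}" for s
    using attained[OF s] hamiltonian_nonneg_at_maximal_slope[OF ham s upper[OF s]] by simp
  have "continuous_on {0..1} q"
  proof (rule continuous_from_closed_graph)
    show "compact {-R..R}" by simp
    show "q \<in> {0..1} \<rightarrow> {-R..R}"
    proof
      show "q s \<in> {- R..R}" if "s \<in> {0..1}" for s
        using bound[OF that attained[OF that]] by (simp add: abs_le_iff)
    qed
    show "closed ((\<lambda>x. (x, q x)) ` {0..1})"
      unfolding closed_sequential_limits
    proof (intro allI impI)
      fix z and y :: "real \<times> real"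
      assume "(\<forall>n. z n \<in> (\<lambda>x. (x, q x)) ` {0..1}) \<and> z \<longlonglongrightarrow> y"
      then have graph: "\<And>n. z n \<in> (\<lambda>x. (x, q x)) ` {0..1}" and lim: "z \<longlonglongrightarrow> y"
        by auto
      have z: "fst (z n) \<in> {0..1} \<and> snd (z n) = q (fst (z n))" for n
        using graph[of n] by auto
      obtain s p where y: "y = (s, p)" by (cases y)
      have s_lim: "(\<lambda>n. fst (z n)) \<longlonglongrightarrow> s" and p_lim: "(\<lambda>n. snd (z n)) \<longlonglongrightarrow> p"
        using tendsto_fst[OF lim] tendsto_snd[OF lim] y by auto
      have s: "s \<in> {0..1}"
        by (rule closed_sequentially[OF _ _ s_lim]) (use z in auto)
      have "(\<lambda>n. k (fst (z n)) (snd (z n))) \<longlonglongrightarrow> k s p"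
        using z s by (intro hamiltonian_tendsto[OF ham s_lim p_lim]) auto
      moreover have "k (fst (z n)) (snd (z n)) = 0" for n using z[of n] zero by simp
      ultimately have kp: "k s p = 0" by (simp add: LIMSEQ_const_iff)
      then have "p \<le> q s" using upper s by simp
      moreover have False if "p < q s"
      proof -
        define x where "x = (p + q s) / 2"
        have x: "p < x" "x < q s" using that by (auto simp: x_def)
        have "\<forall>\<^sub>F n in sequentially. snd (z n) < x" using p_lim x(1) by (rule order_tendstoD)
        then have "\<forall>\<^sub>F n in sequentially. 0 \<le> k (fst (z n)) x"
        proof eventually_elim
          case (elim n)
          then show ?case using upper[of "fst (z n)" x] z[of n] by linarith
        qed
        moreover from z s have "(\<lambda>n. k (fst (z n)) x) \<longlonglongrightarrow> k s x"
          by (intro hamiltonian_tendsto[OF ham s_lim tendsto_const]) auto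
        ultimately have "0 \<le> k s x" using tendsto_lowerbound by fastforce
        then show False
          using hamiltonian_less_inside[OF ham s _ _ x, of 0] kp attained[OF s] by simp
      qed
      ultimately have "p = q s" by (cases "p < q s") auto
      then show "y \<in> (\<lambda>x. (x, q x)) ` {0..1}" using s y by auto
    qed
  qed
  then show ?thesis using attained upper by blast
qed

text \<open>The maximal Eikonal subsolution vanishing at \<open>0\<close> is the primitive of the maximal slope. Both functions
  are kept on the whole line, so that the primitive can serve in test functions.\<close>

definition maximal_primitive ::
  "(real \<Rightarrow> real \<Rightarrow> real) \<Rightarrow> (real \<Rightarrow> real) \<Rightarrow> (real \<Rightarrow> real) \<Rightarrow> bool" where
  "maximal_primitive k q Q \<longleftrightarrow>
     continuous_on UNIV q \<and> (\<forall>t. (Q has_real_derivative q t) (at t)) \<and> Q 0 = 0 \<and>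
     (\<forall>s\<in>{0..1}. k s (q s) \<le> 0 \<and> (\<forall>p. k s p \<le> 0 \<longrightarrow> p \<le> q s))"

lemma maximal_primitive_exists:
  assumes ham: "hamiltonian k" and ne: "\<And>s. s \<in> {0..1} \<Longrightarrow> \<exists>p. k s p \<le> 0"
  shows "\<exists>q Q. maximal_primitive k q Q"
proof -
  obtain q0 where q0: "continuous_on {0..1} q0"
    "\<And>s. s \<in> {0..1} \<Longrightarrow> k s (q0 s) \<le> 0 \<and> (\<forall>p. k s p \<le> 0 \<longrightarrow> p \<le> q0 s)"
    using maximal_slope_exists[OF assms] by blast
  \<comment> \<open>Constant extension of the slope beyond the arc keeps it continuous.\<close>
  define q where "q t = q0 (max 0 (min 1 t))" for t
  have cq: "continuous_on UNIV q"
    unfolding q_def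
    by (intro continuous_on_compose2[OF q0(1)] continuous_intros) auto
  then have "isCont q t" for t by (simp add: continuous_on_eq_continuous_at)
  then have "\<exists>F. \<forall>x. (F has_vector_derivative q x) (at x)"
    using einterval_antiderivative[of "-\<infinity>" \<infinity> q] by auto
  then obtain F where F: "\<And>x. (F has_real_derivative q x) (at x)"
    by (auto simp: has_real_derivative_iff_has_vector_derivative)
  have "((\<lambda>t. F t - F 0) has_real_derivative q x) (at x)" for x
    using F by (auto intro!: derivative_eq_intros)
  then have "maximal_primitive k q (\<lambda>t. F t - F 0)"
    unfolding maximal_primitive_def using cq q0(2) by (auto simp: q_def)
  then show ?thesis by blast
qed

lemma maximal_primitive_continuous_on:
  assumes "maximal_primitive k q Q"
  shows "continuous_on S Q"
  using assms unfolding maximal_primitive_def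
  by (meson DERIV_isCont continuous_at_imp_continuous_on)

lemma maximal_primitive_bounded:
  assumes "maximal_primitive k q Q"
  shows "\<exists>B\<ge>0. \<forall>s\<in>{0..1}. \<bar>Q s\<bar> \<le> B"
proof -
  have "compact (Q ` {0..1})"
    by (intro compact_continuous_image maximal_primitive_continuous_on[OF assms]) simp
  then obtain B where "\<forall>s\<in>{0..1}. \<bar>Q s\<bar> \<le> B"
    using compact_imp_bounded bounded_iff by (metis imageI real_norm_def)
  moreover have "B \<ge> 0" using \<open>\<forall>s\<in>{0..1}. \<bar>Q s\<bar> \<le> B\<close> by (force dest: bspec[of _ _ 0])
  ultimately show ?thesis by blast
qed

lemma subsol_maximal_primitive:
  assumes "maximal_primitive k q Q" "\<And>s. s \<in> {0..1} \<Longrightarrow> l * (Q s - c) \<le> 0"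
  shows "subsol l k (\<lambda>s. Q s - c)"
proof (rule subsolI_differentiable[where D = q])
  show "continuous_on {0..1} (\<lambda>s. Q s - c)"
    by (intro continuous_intros maximal_primitive_continuous_on[OF assms(1)])
  show "((\<lambda>s. Q s - c) has_real_derivative q s) (at s)" for s
    using assms(1) unfolding maximal_primitive_def by (auto intro!: derivative_eq_intros)
  show "l * (Q s - c) + k s (q s) \<le> 0" if "s \<in> {0<..<1}" for s
    using assms(2)[of s] assms(1) that unfolding maximal_primitive_def
    by (simp add: add_nonpos_nonpos)
qed

lemma sigma_eq_maximal_primitive:
  assumes "maximal_primitive (h e) q Q"
  shows "sigma h e = Q 1"
proof -
  have sub: "subsol 0 (h e) Q" using subsol_maximal_primitive[OF assms, of 0 0] by simp
  have max: "w s \<le> Q s" if "subsol 0 (h e) w" "w 0 = 0" "s \<in> {0..1}" for w s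
  proof -
    have "w s - w 0 \<le> Q s - Q 0"
      by (rule subsol_increment_le[OF that(1), of Q q])
        (use assms that(3) in \<open>auto simp: maximal_primitive_def\<close>)
    then show ?thesis using assms that(2) by (simp add: maximal_primitive_def)
  qed
  have Q0: "Q 0 = 0" using assms by (simp add: maximal_primitive_def)
  show ?thesis
    unfolding sigma_def
  proof (rule the_equality)
    show "\<exists>v. subsol 0 (h e) v \<and> v 0 = 0 \<and> v 1 = Q 1 \<and>
      (\<forall>w. subsol 0 (h e) w \<and> w 0 = 0 \<longrightarrow> (\<forall>s\<in>{0..1}. w s \<le> v s))"
      using sub Q0 max by blast
    fix r assume "\<exists>v. subsol 0 (h e) v \<and> v 0 = 0 \<and> v 1 = r \<and>
      (\<forall>w. subsol 0 (h e) w \<and> w 0 = 0 \<longrightarrow> (\<forall>s\<in>{0..1}. w s \<le> v s))"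
    then obtain v where v: "subsol 0 (h e) v" "v 0 = 0" "v 1 = r"
      "\<And>w s. subsol 0 (h e) w \<Longrightarrow> w 0 = 0 \<Longrightarrow> s \<in> {0..1} \<Longrightarrow> w s \<le> v s"
      by blast
    have "Q 1 \<le> v 1" using v(4)[OF sub Q0] by simp
    moreover have "v 1 \<le> Q 1" using max[OF v(1,2)] by simp
    ultimately show "r = Q 1" using v(3) by simp
  qed
qed

text \<open>Slopes that are admissible up to a small error exceed the maximal slope only a little, uniformly along
  the arc.\<close>

lemma maximal_slope_upper_stable:
  assumes ham: "hamiltonian k" and prim: "maximal_primitive k q Q" and \<epsilon>: "\<epsilon> > 0"
  shows "\<exists>\<delta>>0. \<forall>s\<in>{0..1}. \<forall>p. k s p \<le> \<delta> \<longrightarrow> p \<le> q s + \<epsilon>"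
proof -
  have q: "continuous_on UNIV q" "\<And>s. s \<in> {0..1} \<Longrightarrow> k s (q s) \<le> 0"
    "\<And>s p. s \<in> {0..1} \<Longrightarrow> k s p \<le> 0 \<Longrightarrow> p \<le> q s"
    using prim by (auto simp: maximal_primitive_def)
  have "continuous_on {0..1} (\<lambda>s. k s (q s + \<epsilon>))"
    by (intro hamiltonian_continuous_on_compose[OF ham] continuous_intros
        continuous_on_subset[OF q(1)]) auto
  then obtain s0 where s0: "s0 \<in> {0..1}" "\<And>s. s \<in> {0..1} \<Longrightarrow> k s0 (q s0 + \<epsilon>) \<le> k s (q s + \<epsilon>)"
    using continuous_attains_inf[of "{0..1::real}" "\<lambda>s. k s (q s + \<epsilon>)"] by auto
  define \<delta> where "\<delta> = k s0 (q s0 + \<epsilon>) / 2"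
  have "\<delta> > 0" using q(3)[OF s0(1), of "q s0 + \<epsilon>"] \<epsilon> by (fastforce simp: \<delta>_def)
  moreover have "p \<le> q s + \<epsilon>" if s: "s \<in> {0..1}" and p: "k s p \<le> \<delta>" for s p
  proof (rule ccontr)
    assume "\<not> p \<le> q s + \<epsilon>"
    then have "k s (q s + \<epsilon>) \<le> \<delta>"
      using hamiltonian_sublevel_interval[OF ham s _ p, of "q s"] q(2)[OF s] \<open>\<delta> > 0\<close> \<epsilon> by simp
    then show False using s0(2)[OF s] \<open>\<delta> > 0\<close> by (simp add: \<delta>_def)
  qed
  ultimately show ?thesis by blast
qed

text \<open>If the minimum of \<open>k s\<close> is negative, a slightly smaller slope lies strictly inside the sublevel
  interval and leaves the room \<open>\<delta>\<close> in the equation, which later absorbs the term \<open>\<lambda> w\<close>.\<close>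

lemma maximal_slope_lower_stable:
  assumes ham: "hamiltonian k" and prim: "maximal_primitive k q Q"
    and neg: "\<And>s. s \<in> {0..1} \<Longrightarrow> \<exists>p. k s p < 0" and \<epsilon>0: "\<epsilon>0 > 0"
  shows "\<exists>\<epsilon> \<delta>. 0 < \<epsilon> \<and> \<epsilon> \<le> \<epsilon>0 \<and> \<delta> > 0 \<and> (\<forall>s\<in>{0..1}. k s (q s - \<epsilon>) \<le> - \<delta>)"
proof -
  have q: "continuous_on UNIV q" "\<And>s. s \<in> {0..1} \<Longrightarrow> k s (q s) \<le> 0"
    "\<And>s p. s \<in> {0..1} \<Longrightarrow> k s p \<le> 0 \<Longrightarrow> p \<le> q s"
    using prim by (auto simp: maximal_primitive_def)
  obtain c where c: "\<And>s. s \<in> {0..1} \<Longrightarrow> (\<exists>p. k s p = c) \<and> (\<forall>p. c \<le> k s p)"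
    using ham unfolding hamiltonian_def by metis
  obtain p0 where "k 0 p0 < 0" using neg[of 0] by auto
  moreover have "c \<le> k 0 p0" using c[of 0] by auto
  ultimately have "c < 0" by simp
  \<comment> \<open>The maximal slope for the intermediate level \<open>c / 2\<close> stays strictly below \<open>q\<close>.\<close>
  have "hamiltonian (\<lambda>s p. k s p - c / 2)"
    by (rule hamiltonian_shift[OF ham])
  moreover have "\<exists>p. k s p - c / 2 \<le> 0" if s: "s \<in> {0..1}" for s
  proof -
    obtain p where "k s p = c" using c[OF s] by blast
    then show ?thesis using \<open>c < 0\<close> by (intro exI[of _ p]) simp
  qed
  ultimately obtain r where r: "continuous_on {0..1} r" "\<And>s. s \<in> {0..1} \<Longrightarrow> k s (r s) \<le> c / 2"
    using maximal_slope_exists[of "\<lambda>s p. k s p - c / 2"] by auto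
  have less: "r s < q s" if s: "s \<in> {0..1}" for s
  proof -
    have "r s \<le> q s" using r(2)[OF s] q(3)[OF s] \<open>c < 0\<close> by simp
    moreover have "r s \<noteq> q s"
      using r(2)[OF s] hamiltonian_nonneg_at_maximal_slope[OF ham s q(3)[OF s]] \<open>c < 0\<close> by auto
    ultimately show ?thesis by simp
  qed
  have "continuous_on {0..1} (\<lambda>s. q s - r s)"
    by (intro continuous_intros r(1) continuous_on_subset[OF q(1)]) auto
  then obtain s0 where s0: "s0 \<in> {0..1}" "\<And>s. s \<in> {0..1} \<Longrightarrow> q s0 - r s0 \<le> q s - r s"
    using continuous_attains_inf[of "{0..1::real}" "\<lambda>s. q s - r s"] by auto
  define \<epsilon> where "\<epsilon> = min \<epsilon>0 ((q s0 - r s0) / 2)"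
  have \<epsilon>: "0 < \<epsilon>" "\<epsilon> \<le> \<epsilon>0" using less[OF s0(1)] \<epsilon>0 by (auto simp: \<epsilon>_def)
  have "continuous_on {0..1} (\<lambda>s. k s (q s - \<epsilon>))"
    by (intro hamiltonian_continuous_on_compose[OF ham] continuous_intros
        continuous_on_subset[OF q(1)]) auto
  then obtain s1 where s1: "s1 \<in> {0..1}" "\<And>s. s \<in> {0..1} \<Longrightarrow> k s (q s - \<epsilon>) \<le> k s1 (q s1 - \<epsilon>)"
    using continuous_attains_sup[of "{0..1::real}" "\<lambda>s. k s (q s - \<epsilon>)"] by auto
  have "\<epsilon> \<le> (q s0 - r s0) / 2" unfolding \<epsilon>_def by (rule min.cobounded2)
  then have "r s1 < q s1 - \<epsilon>" using s0(2)[OF s1(1)] less[OF s0(1)] by argo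
  then have "k s1 (q s1 - \<epsilon>) < 0"
    using hamiltonian_less_inside[OF ham s1(1), of "r s1" 0 "q s1"] r(2)[OF s1(1)] q(2)[OF s1(1)]
      \<open>c < 0\<close> \<epsilon> by simp
  then show ?thesis
    using \<epsilon> s1(2) by (intro exI[of _ \<epsilon>] exI[of _ "- k s1 (q s1 - \<epsilon>)"]) auto
qed

text \<open>If the minimum is \<open>0\<close>, only one slope is admissible at each point, and reversing the arc reverses
  the maximal subsolution.\<close>

lemma maximal_primitive_reverse:
  assumes ham: "hamiltonian k" and nonneg: "\<And>s p. s \<in> {0..1} \<Longrightarrow> 0 \<le> k s p"
    and rev: "\<And>s p. s \<in> {0..1} \<Longrightarrow> k' s p = k (1 - s) (- p)"
    and prim: "maximal_primitive k q Q" and prim': "maximal_primitive k' q' Q'"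
    and s: "s \<in> {0..1}"
  shows "Q' 1 - Q' (1 - s) = - Q s"
proof -
  have single: "p = r" if "t \<in> {0..1}" "k t p \<le> 0" "k t r \<le> 0" for t p r
    using hamiltonian_less_inside[OF ham that(1), of p 0 r] nonneg[OF that(1)]
      hamiltonian_less_inside[OF ham that(1), of r 0 p] that dense not_le
    by (metis linorder_neqE_linordered_idom)
  have q': "q' t = - q (1 - t)" if t: "t \<in> {0..1}" for t
  proof -
    have "k' t (q' t) \<le> 0" using prim' t unfolding maximal_primitive_def by blast
    then have "k (1 - t) (- q' t) \<le> 0" using rev[OF t] by simp
    moreover have "k (1 - t) (q (1 - t)) \<le> 0" using prim t by (auto simp: maximal_primitive_def)
    ultimately have "- q' t = q (1 - t)" using single[of "1 - t"] t by auto
    then show ?thesis by simp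
  qed
  have dQ: "(Q has_real_derivative q t) (at t)" and dQ': "(Q' has_real_derivative q' t) (at t)" for t
    using prim prim' by (auto simp: maximal_primitive_def)
  have "((\<lambda>t. Q' t - Q (1 - t)) has_real_derivative 0) (at t within {0..1})" if "t \<in> {0..1}" for t
  proof -
    have "((\<lambda>t. Q' t - Q (1 - t)) has_real_derivative q' t + q (1 - t)) (at t)"
      by (rule derivative_eq_intros DERIV_chain2[OF dQ] dQ' refl)+ simp
    then show ?thesis using q'[OF that] by (simp add: has_field_derivative_at_within)
  qed
  then obtain c where "\<And>t. t \<in> {0..1} \<Longrightarrow> Q' t - Q (1 - t) = c"
    using has_field_derivative_zero_constant[of "{0..1::real}" "\<lambda>t. Q' t - Q (1 - t)"] by auto
  from this[of 1] this[of "1 - s"] show ?thesis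
    using s prim by (auto simp: maximal_primitive_def)
qed

section \<open>The functions \<open>\<rho>\<^sub>\<lambda>\<close> on one arc\<close>

text \<open>Every competitor in the definition of \<open>\<rho>\<^sub>\<lambda>\<close> may be replaced by its maximum with a low translate
  of the maximal Eikonal subsolution. The resulting lower bound is uniform in \<open>\<lambda>\<close>; by coercivity it bounds
  the slopes, which makes competitors comparable for different \<open>\<lambda>\<close>.\<close>

lemma subsol_barrier:
  assumes prim: "maximal_primitive k q Q"
  shows "\<exists>M\<ge>0. \<forall>l>0. \<forall>\<alpha>\<ge>A. \<forall>w. subsol l k w \<and> w 0 \<le> \<alpha> \<longrightarrow>
    (\<exists>w'. subsol l k w' \<and> w' 0 \<le> \<alpha> \<and> w 1 \<le> w' 1 \<and> (\<forall>s\<in>{0..1}. - M \<le> w' s))"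
proof -
  obtain B where B: "B \<ge> 0" "\<And>s. s \<in> {0..1} \<Longrightarrow> \<bar>Q s\<bar> \<le> B"
    using maximal_primitive_bounded[OF prim] by blast
  define K where "K = B + \<bar>A\<bar>"
  have Q: "Q 0 = 0" using prim by (simp add: maximal_primitive_def)
  have "\<exists>w'. subsol l k w' \<and> w' 0 \<le> \<alpha> \<and> w 1 \<le> w' 1 \<and> (\<forall>s\<in>{0..1}. - (B + K) \<le> w' s)"
    if "l > 0" "A \<le> \<alpha>" "subsol l k w" "w 0 \<le> \<alpha>" for l \<alpha> w
  proof (intro exI conjI ballI)
    have "l * (Q s - K) \<le> 0" if "s \<in> {0..1}" for s
      using B(2)[OF that] \<open>l > 0\<close> by (intro mult_nonneg_nonpos) (auto simp: K_def)
    then show "subsol l k (\<lambda>s. max (w s) (Q s - K))"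
      using subsol_max[OF that(3) subsol_maximal_primitive[OF prim]] by simp
    show "max (w 0) (Q 0 - K) \<le> \<alpha>" using that Q B(1) by (auto simp: K_def)
    show "w 1 \<le> max (w 1) (Q 1 - K)" by simp
    show "- (B + K) \<le> max (w s) (Q s - K)" if "s \<in> {0..1}" for s
      using B(2)[OF that] by (auto simp: abs_le_iff le_max_iff_disj)
  qed
  moreover have "B + K \<ge> 0" using B(1) by (simp add: K_def)
  ultimately show ?thesis by blast
qed

lemma hamiltonian_slope_bound:
  assumes "hamiltonian k"
  shows "\<exists>R\<ge>0. \<forall>s\<in>{0..1}. \<forall>p. k s p \<le> B \<longrightarrow> \<bar>p\<bar> \<le> R"
proof -
  obtain R where R: "\<And>s p. s \<in> {0..1} \<Longrightarrow> R \<le> \<bar>p\<bar> \<Longrightarrow> B + 1 \<le> k s p"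
    using assms unfolding hamiltonian_def by meson
  have "\<bar>p\<bar> \<le> \<bar>R\<bar>" if "s \<in> {0..1}" "k s p \<le> B" for s p
    using R[OF that(1), of p] that(2) by linarith
  then show ?thesis by (intro exI[of _ "\<bar>R\<bar>"]) auto
qed

lemma subsol_test_bound:
  assumes "- M \<le> x" "l > 0" "l * x + y \<le> (0::real)"
  shows "y \<le> l * M"
proof -
  have "- (l * M) \<le> l * x" using mult_left_mono[OF assms(1), of l] assms(2) by simp
  then show ?thesis using assms(3) by simp
qed

lemma rho_competitors:
  assumes ham: "hamiltonian (h e)" and prim: "maximal_primitive (h e) q Q" and l: "l > 0"
  shows "bdd_above {w 1 | w. subsol l (h e) w \<and> w 0 \<le> \<alpha>}"
    and "{w 1 | w. subsol l (h e) w \<and> w 0 \<le> \<alpha>} \<noteq> {}"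
proof -
  obtain M where M: "M \<ge> 0" "\<And>w. subsol l (h e) w \<and> w 0 \<le> \<alpha> \<Longrightarrow>
    \<exists>w'. subsol l (h e) w' \<and> w' 0 \<le> \<alpha> \<and> w 1 \<le> w' 1 \<and> (\<forall>s\<in>{0..1}. - M \<le> w' s)"
    using subsol_barrier[OF prim, of \<alpha>] l by blast
  obtain R where R: "\<And>s p. s \<in> {0..1} \<Longrightarrow> h e s p \<le> l * M \<Longrightarrow> \<bar>p\<bar> \<le> R"
    using hamiltonian_slope_bound[OF ham] by metis
  have "w 1 \<le> \<alpha> + R" if w: "subsol l (h e) w" "w 0 \<le> \<alpha>" for w
  proof -
    obtain w' where w': "subsol l (h e) w'" "w' 0 \<le> \<alpha>" "w 1 \<le> w' 1" "\<And>s. s \<in> {0..1} \<Longrightarrow> - M \<le> w' s"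
      using M w by blast
    have "w' 1 - w' 0 \<le> R * 1 - R * 0"
    proof (rule subsol_increment_le[OF w'(1), of "\<lambda>t. R * t" "\<lambda>_. R"])
      show "p \<le> R" if "s \<in> {0<..<1}" "l * w' s + h e s p \<le> 0" for s p
        using R[of s p] subsol_test_bound[OF w'(4) l that(2)] that(1) by auto
    qed (auto intro!: derivative_eq_intros)
    then show ?thesis using w' by simp
  qed
  then show "bdd_above {w 1 | w. subsol l (h e) w \<and> w 0 \<le> \<alpha>}"
    by (intro bdd_aboveI[of _ "\<alpha> + R"]) blast
  obtain B where B: "\<And>s. s \<in> {0..1} \<Longrightarrow> \<bar>Q s\<bar> \<le> B" "B \<ge> 0"
    using maximal_primitive_bounded[OF prim] by blast
  have "l * (Q s - (B + \<bar>\<alpha>\<bar>)) \<le> 0" if "s \<in> {0..1}" for s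
    using B(1)[OF that] l by (intro mult_nonneg_nonpos) auto
  then have "subsol l (h e) (\<lambda>s. Q s - (B + \<bar>\<alpha>\<bar>))" by (rule subsol_maximal_primitive[OF prim])
  moreover have "Q 0 - (B + \<bar>\<alpha>\<bar>) \<le> \<alpha>" using prim B(2) by (simp add: maximal_primitive_def)
  ultimately show "{w 1 | w. subsol l (h e) w \<and> w 0 \<le> \<alpha>} \<noteq> {}" by blast
qed

lemma rho_upper:
  assumes "hamiltonian (h e)" "maximal_primitive (h e) q Q" "l > 0" "subsol l (h e) w" "w 0 \<le> \<alpha>"
  shows "w 1 \<le> rho h l \<alpha> e"
  unfolding rho_def using rho_competitors(1)[where h = h and e = e] assms
  by (intro cSup_upper) blast+

lemma rho_least:
  assumes "hamiltonian (h e)" "maximal_primitive (h e) q Q" "l > 0"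
    "\<And>w. subsol l (h e) w \<Longrightarrow> w 0 \<le> \<alpha> \<Longrightarrow> w 1 \<le> B"
  shows "rho h l \<alpha> e \<le> B"
  unfolding rho_def using rho_competitors(2)[where h = h and e = e, OF assms(1-3)] assms(4)
  by (intro cSup_least) blast+

lemma rho_mono:
  assumes ham: "hamiltonian (h e)" and prim: "maximal_primitive (h e) q Q" and "l > 0" "\<alpha> \<le> \<alpha>'"
  shows "rho h l \<alpha> e \<le> rho h l \<alpha>' e"
  using assms by (intro rho_least[where h = h and e = e, OF ham prim] rho_upper[where h = h and e = e, OF ham prim]) auto

text \<open>Lowering a subsolution by \<open>\<kappa>\<close> creates room \<open>l \<kappa>\<close> in the equation. By uniform continuity of
  the Hamiltonian on the bounded range of relevant slopes part of the room can be spent on a tilt, so the end value drops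
  by less than \<open>\<kappa>\<close>.\<close>

lemma rho_strict_contraction:
  assumes ham: "hamiltonian (h e)" and prim: "maximal_primitive (h e) q Q" and l: "l > 0"
    and less: "\<alpha> < \<alpha>'"
  shows "rho h l \<alpha>' e < rho h l \<alpha> e + (\<alpha>' - \<alpha>)"
proof -
  define \<kappa> where "\<kappa> = \<alpha>' - \<alpha>"
  have \<kappa>: "\<kappa> > 0" using less by (simp add: \<kappa>_def)
  obtain M where M: "M \<ge> 0" "\<And>w. subsol l (h e) w \<and> w 0 \<le> \<alpha>' \<Longrightarrow>
    \<exists>w'. subsol l (h e) w' \<and> w' 0 \<le> \<alpha>' \<and> w 1 \<le> w' 1 \<and> (\<forall>s\<in>{0..1}. - M \<le> w' s)"
    using subsol_barrier[OF prim, of \<alpha>'] l by blast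
  obtain R where R: "\<And>s p. s \<in> {0..1} \<Longrightarrow> h e s p \<le> l * M \<Longrightarrow> \<bar>p\<bar> \<le> R"
    using hamiltonian_slope_bound[OF ham] by metis
  let ?K = "{0..1} \<times> {- R - 1..R + 1}"
  have "continuous_on ?K (\<lambda>(s, p). h e s p)"
    using ham unfolding hamiltonian_def by (auto elim: continuous_on_subset)
  then have "uniformly_continuous_on ?K (\<lambda>(s, p). h e s p)"
    by (intro compact_uniformly_continuous compact_Times) auto
  then obtain d where d: "d > 0" "\<And>x y. x \<in> ?K \<Longrightarrow> y \<in> ?K \<Longrightarrow> dist y x < d \<Longrightarrow>
    dist ((\<lambda>(s, p). h e s p) y) ((\<lambda>(s, p). h e s p) x) < l * \<kappa> / 2"
    unfolding uniformly_continuous_on_def using l \<kappa> by (metis half_gt_zero mult_pos_pos)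
  define \<epsilon> where "\<epsilon> = min (d / 2) (min 1 (\<kappa> / 2))"
  have \<epsilon>: "0 < \<epsilon>" "\<epsilon> < d" "\<epsilon> \<le> 1" "\<epsilon> \<le> \<kappa> / 2" using d(1) \<kappa> by (auto simp: \<epsilon>_def)
  have "rho h l \<alpha>' e \<le> rho h l \<alpha> e + \<kappa> - \<epsilon>"
  proof (rule rho_least[where h = h and e = e, OF ham prim l])
    fix w assume w: "subsol l (h e) w" "w 0 \<le> \<alpha>'"
    obtain w' where w': "subsol l (h e) w'" "w' 0 \<le> \<alpha>'" "w 1 \<le> w' 1" "\<And>s. s \<in> {0..1} \<Longrightarrow> - M \<le> w' s"
      using M w by blast
    have "subsol l (h e) (\<lambda>t. w' t + \<epsilon> * t - \<kappa>)"
    proof (rule subsol_tilt[OF w'(1)])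
      fix s p assume s: "s \<in> {0<..<1::real}" and le: "l * w' s + h e s p \<le> 0"
      have "\<bar>p\<bar> \<le> R" using R[of s p] subsol_test_bound[OF w'(4) l le] s by auto
      then have "(s, p) \<in> ?K" "(s, p + \<epsilon>) \<in> ?K" using s \<epsilon> by auto
      moreover have "dist (s, p + \<epsilon>) (s, p) < d" using \<epsilon> by (simp add: dist_Pair_Pair dist_real_def)
      ultimately have "dist (h e s (p + \<epsilon>)) (h e s p) < l * \<kappa> / 2" using d(2) by fastforce
      then have "h e s (p + \<epsilon>) \<le> h e s p + l * \<kappa> / 2" unfolding dist_real_def by linarith
      moreover have "l * (\<epsilon> * s) \<le> l * (\<kappa> / 2)"
      proof -
        have "\<epsilon> * s \<le> \<epsilon> * 1" using \<epsilon> s by (intro mult_left_mono) auto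
        then show ?thesis using \<epsilon> l by (intro mult_left_mono) linarith+
      qed
      ultimately show "l * (w' s + \<epsilon> * s - \<kappa>) + h e s (p + \<epsilon>) \<le> 0"
        using le by (simp add: algebra_simps)
    qed
    then have "w' 1 + \<epsilon> * 1 - \<kappa> \<le> rho h l \<alpha> e"
      by (rule rho_upper[where h = h and e = e, OF ham prim l]) (use w' in \<open>simp add: \<kappa>_def\<close>)
    then show "w 1 \<le> rho h l \<alpha> e + \<kappa> - \<epsilon>" using w' by simp
  qed
  then show ?thesis using \<epsilon> by (simp add: \<kappa>_def)
qed

section \<open>The limit of \<open>\<rho>\<^sub>\<lambda>\<close> as \<open>\<lambda>\<close> vanishes\<close>

text \<open>For small \<open>\<lambda>\<close> the competitors above the barrier are nearly subsolutions of the Eikonal equation. The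
  increment from \<open>s = 0\<close> bounds \<open>\<rho>\<^sub>\<lambda>\<close>; increments from other points are what the argument on the
  reversed arc below needs.\<close>

lemma eventually_competitors_almost_eikonal:
  assumes ham: "hamiltonian k" and prim: "maximal_primitive k q Q"
    and lam: "\<And>n. lam n > 0" "lam \<longlonglongrightarrow> 0" and \<alpha>: "\<alpha> \<longlonglongrightarrow> a" and \<epsilon>: "\<epsilon> > 0"
  shows "\<forall>\<^sub>F n in sequentially. \<forall>w. subsol (lam n) k w \<and> w 0 \<le> \<alpha> n \<longrightarrow>
    (\<exists>w'. subsol (lam n) k w' \<and> w' 0 \<le> \<alpha> n \<and> w 1 \<le> w' 1 \<and>
      (\<forall>s\<in>{0..1}. w' 1 - w' s \<le> Q 1 - Q s + \<epsilon>))"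
proof -
  obtain M where M: "M \<ge> 0" "\<And>l \<beta> w. l > 0 \<Longrightarrow> a - 1 \<le> \<beta> \<Longrightarrow> subsol l k w \<and> w 0 \<le> \<beta> \<Longrightarrow>
    \<exists>w'. subsol l k w' \<and> w' 0 \<le> \<beta> \<and> w 1 \<le> w' 1 \<and> (\<forall>s\<in>{0..1}. - M \<le> w' s)"
    using subsol_barrier[OF prim, of "a - 1"] by blast
  obtain \<delta> where \<delta>: "\<delta> > 0" "\<And>s p. s \<in> {0..1} \<Longrightarrow> k s p \<le> \<delta> \<Longrightarrow> p \<le> q s + \<epsilon>"
    using maximal_slope_upper_stable[OF ham prim \<epsilon>] by blast
  have "(\<lambda>n. lam n * M) \<longlonglongrightarrow> 0 * M" by (intro tendsto_intros lam)
  then have "\<forall>\<^sub>F n in sequentially. lam n * M < \<delta>" by (rule order_tendstoD) (use \<delta> in simp)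
  moreover have "\<forall>\<^sub>F n in sequentially. a - 1 < \<alpha> n" by (rule order_tendstoD[OF \<alpha>]) simp
  ultimately show ?thesis
  proof eventually_elim
    case (elim n)
    show ?case
    proof (intro allI impI)
      fix w assume "subsol (lam n) k w \<and> w 0 \<le> \<alpha> n"
      then obtain w' where w': "subsol (lam n) k w'" "w' 0 \<le> \<alpha> n" "w 1 \<le> w' 1"
        "\<And>s. s \<in> {0..1} \<Longrightarrow> - M \<le> w' s"
        using M(2)[OF lam(1)[of n]] elim by (metis less_imp_le)
      have d: "((\<lambda>t. Q t + \<epsilon> * t) has_real_derivative q t + \<epsilon>) (at t)" for t
        using prim unfolding maximal_primitive_def by (auto intro!: derivative_eq_intros)
      have c: "continuous_on UNIV (\<lambda>t. q t + \<epsilon>)"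
        using prim unfolding maximal_primitive_def by (auto intro!: continuous_intros)
      have "w' 1 - w' s \<le> Q 1 - Q s + \<epsilon>" if s: "s \<in> {0..1}" for s
      proof -
        have "w' 1 - w' s \<le> (Q 1 + \<epsilon> * 1) - (Q s + \<epsilon> * s)"
        proof (rule subsol_increment_le[OF w'(1) d c])
          show "p \<le> q t + \<epsilon>" if "t \<in> {0<..<1}" "lam n * w' t + k t p \<le> 0" for t p
            using subsol_test_bound[OF w'(4) lam(1) that(2)] elim that(1)
            by (intro \<delta>(2)) auto
        qed (use s in auto)
        moreover have "0 \<le> \<epsilon> * s" using s \<epsilon> by simp
        ultimately show ?thesis by simp
      qed
      then show "\<exists>w'. subsol (lam n) k w' \<and> w' 0 \<le> \<alpha> n \<and> w 1 \<le> w' 1 \<and>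
        (\<forall>s\<in>{0..1}. w' 1 - w' s \<le> Q 1 - Q s + \<epsilon>)"
        using w' by blast
    qed
  qed
qed

lemma rho_eventually_le:
  assumes ham: "hamiltonian (h e)" and prim: "maximal_primitive (h e) q Q"
    and lam: "\<And>n. lam n > 0" "lam \<longlonglongrightarrow> 0" and \<alpha>: "\<alpha> \<longlonglongrightarrow> a" and \<epsilon>: "\<epsilon> > 0"
  shows "\<forall>\<^sub>F n in sequentially. rho h (lam n) (\<alpha> n) e \<le> \<alpha> n + Q 1 + \<epsilon>"
  using eventually_competitors_almost_eikonal[OF assms]
proof eventually_elim
  case (elim n)
  show ?case
  proof (rule rho_least[where h = h and e = e, OF ham prim lam(1)])
    fix w assume "subsol (lam n) (h e) w" "w 0 \<le> \<alpha> n"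
    then obtain w' where w': "w' 0 \<le> \<alpha> n" "w 1 \<le> w' 1" "\<forall>s\<in>{0..1}. w' 1 - w' s \<le> Q 1 - Q s + \<epsilon>"
      using elim by blast
    have "w' 1 - w' 0 \<le> Q 1 - Q 0 + \<epsilon>" using w'(3) by auto
    moreover have "Q 0 = 0" using prim by (simp add: maximal_primitive_def)
    ultimately show "w 1 \<le> \<alpha> n + Q 1 + \<epsilon>" using w'(1,2) by linarith
  qed
qed

text \<open>The competitor \<open>\<alpha> n + Q s - \<epsilon>' s\<close> has slope \<open>q - \<epsilon>'\<close>, so the equation leaves room for the small
  term \<open>\<lambda> w\<close> of either sign.\<close>

lemma rho_eventually_ge_negative_minimum:
  assumes ham: "hamiltonian (h e)" and prim: "maximal_primitive (h e) q Q"
    and neg: "\<And>s. s \<in> {0..1} \<Longrightarrow> \<exists>p. h e s p < 0"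
    and lam: "\<And>n. lam n > 0" "lam \<longlonglongrightarrow> 0" and \<alpha>: "\<alpha> \<longlonglongrightarrow> a" and \<epsilon>: "\<epsilon> > 0"
  shows "\<forall>\<^sub>F n in sequentially. \<alpha> n + Q 1 - \<epsilon> \<le> rho h (lam n) (\<alpha> n) e"
proof -
  obtain \<epsilon>' \<delta> where \<epsilon>': "0 < \<epsilon>'" "\<epsilon>' \<le> \<epsilon>" and \<delta>: "\<delta> > 0"
    "\<And>s. s \<in> {0..1} \<Longrightarrow> h e s (q s - \<epsilon>') \<le> - \<delta>"
    using maximal_slope_lower_stable[OF ham prim neg \<epsilon>] by blast
  obtain B where B: "B \<ge> 0" "\<And>s. s \<in> {0..1} \<Longrightarrow> \<bar>Q s\<bar> \<le> B"
    using maximal_primitive_bounded[OF prim] by blast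
  have "(\<lambda>n. lam n * (\<alpha> n + B)) \<longlonglongrightarrow> 0 * (a + B)" by (intro tendsto_intros lam \<alpha>)
  then have "\<forall>\<^sub>F n in sequentially. lam n * (\<alpha> n + B) < \<delta>"
    by (rule order_tendstoD) (use \<delta> in simp)
  then show ?thesis
  proof eventually_elim
    case (elim n)
    have "subsol (lam n) (h e) (\<lambda>s. \<alpha> n + Q s - \<epsilon>' * s)"
    proof (rule subsolI_differentiable[where D = "\<lambda>s. q s - \<epsilon>'"])
      show "continuous_on {0..1} (\<lambda>s. \<alpha> n + Q s - \<epsilon>' * s)"
        by (intro continuous_intros maximal_primitive_continuous_on[OF prim])
      show "((\<lambda>s. \<alpha> n + Q s - \<epsilon>' * s) has_real_derivative q s - \<epsilon>') (at s)" for s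
        using prim unfolding maximal_primitive_def by (auto intro!: derivative_eq_intros)
      fix s :: real assume s: "s \<in> {0<..<1}"
      have "\<epsilon>' * s \<ge> 0" using \<epsilon>' s by simp
      then have "\<alpha> n + Q s - \<epsilon>' * s \<le> \<alpha> n + B" using B(2)[of s] s by auto
      then have "lam n * (\<alpha> n + Q s - \<epsilon>' * s) \<le> lam n * (\<alpha> n + B)"
        using lam(1)[of n] by (intro mult_left_mono) auto
      then show "lam n * (\<alpha> n + Q s - \<epsilon>' * s) + h e s (q s - \<epsilon>') \<le> 0"
        using elim \<delta>(2)[of s] s by auto
    qed
    then have "\<alpha> n + Q 1 - \<epsilon>' * 1 \<le> rho h (lam n) (\<alpha> n) e"
      by (rule rho_upper[where h = h and e = e, OF ham prim lam(1)]) (use prim in \<open>simp add: maximal_primitive_def\<close>)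
    then show ?case using \<epsilon>' by simp
  qed
qed

text \<open>Where \<open>a + Q\<close> is nonpositive, the maximal Eikonal subsolution starting at \<open>min (\<alpha> n) a\<close> is itself a
  competitor for every \<open>\<lambda> > 0\<close>.\<close>

lemma rho_eventually_ge_nonpositive:
  assumes ham: "hamiltonian (h e)" and prim: "maximal_primitive (h e) q Q"
    and nonpos: "\<And>s. s \<in> {0..1} \<Longrightarrow> a + Q s \<le> 0"
    and lam: "\<And>n. lam n > 0" and \<alpha>: "\<alpha> \<longlonglongrightarrow> a" and \<epsilon>: "\<epsilon> > 0"
  shows "\<forall>\<^sub>F n in sequentially. \<alpha> n + Q 1 - \<epsilon> \<le> rho h (lam n) (\<alpha> n) e"
proof -
  have "\<forall>\<^sub>F n in sequentially. \<alpha> n < a + \<epsilon>" by (rule order_tendstoD[OF \<alpha>]) (use \<epsilon> in simp)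
  then show ?thesis
  proof eventually_elim
    case (elim n)
    define c where "c = - min (\<alpha> n) a"
    have "subsol (lam n) (h e) (\<lambda>s. Q s - c)"
    proof (rule subsol_maximal_primitive[OF prim])
      show "lam n * (Q s - c) \<le> 0" if "s \<in> {0..1}" for s
        using nonpos[OF that] lam[of n] by (intro mult_nonneg_nonpos) (auto simp: c_def)
    qed
    then have "Q 1 - c \<le> rho h (lam n) (\<alpha> n) e"
      by (rule rho_upper[where h = h and e = e, OF ham prim lam]) (use prim in \<open>simp add: maximal_primitive_def c_def\<close>)
    then show ?case using elim \<epsilon> by (auto simp: c_def min_def split: if_splits)
  qed
qed

text \<open>With \<open>k\<close> nonnegative, the inequality at a touching point forces \<open>w \<le> 0\<close> there, and touching
  points are dense.\<close>

lemma subsol_nonpos: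
  assumes sub: "subsol l k w" and l: "l > 0"
    and nonneg: "\<And>s p. s \<in> {0..1} \<Longrightarrow> 0 \<le> k s p" and s: "s \<in> {0..1}"
  shows "w s \<le> 0"
proof (rule ccontr)
  assume "\<not> w s \<le> 0"
  have "continuous_on {0..1} w" using sub by (simp add: subsol_def)
  then obtain d where d: "d > 0" "\<And>t. t \<in> {0..1} \<Longrightarrow> dist t s < d \<Longrightarrow> dist (w t) (w s) < w s"
    using s \<open>\<not> w s \<le> 0\<close> unfolding continuous_on_iff by (metis not_le)
  define a where "a = max 0 (s - d / 2)"
  define b where "b = min 1 (s + d / 2)"
  have ab: "0 \<le> a" "a < b" "b \<le> 1" using s d(1) by (auto simp: a_def b_def)
  obtain t p where t: "t \<in> {a<..<b}" "l * w t + k t p \<le> 0"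
    using subsol_touched_densely[OF sub ab] by blast
  have "t \<in> {0..1}" "dist t s < d" using t(1) d(1) by (auto simp: a_def b_def dist_real_def)
  then have "w t > 0" "0 \<le> k t p" using d(2)[of t] nonneg by (auto simp: dist_real_def)
  then show False using t(2) mult_pos_pos[OF l, of "w t"] by linarith
qed

text \<open>Let the minimum be \<open>0\<close> along the arc. Competitors on the reversed arc \<open>f\<close> are nonpositive at the
  point with parameter \<open>1 - s\<close> and then increase by at most \<open>Q' 1 - Q' (1 - s) = - Q s\<close> in the limit. Hence the
  limit value at their end, which is the origin of \<open>e\<close>, keeps \<open>a + Q\<close> nonpositive along \<open>e\<close>.\<close>

lemma limit_nonpositive_along_arc:
  assumes ham: "hamiltonian (h e)" and ham': "hamiltonian (h f)"
    and prim: "maximal_primitive (h e) q Q" and prim': "maximal_primitive (h f) q' Q'"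
    and rev: "\<And>s p. s \<in> {0..1} \<Longrightarrow> h f s p = h e (1 - s) (- p)"
    and nonneg: "\<And>s p. s \<in> {0..1} \<Longrightarrow> 0 \<le> h e s p"
    and lam: "\<And>n. lam n > 0" "lam \<longlonglongrightarrow> 0" and \<beta>: "\<beta> \<longlonglongrightarrow> b" and \<alpha>: "\<alpha> \<longlonglongrightarrow> a"
    and le: "\<And>n. \<alpha> n \<le> rho h (lam n) (\<beta> n) f"
    and s: "s \<in> {0..1}"
  shows "a + Q s \<le> 0"
proof (rule field_le_epsilon)
  fix \<epsilon> :: real assume "\<epsilon> > 0"
  have "\<forall>\<^sub>F n in sequentially. \<alpha> n \<le> - Q s + \<epsilon>"
    using eventually_competitors_almost_eikonal[OF ham' prim' lam \<beta> \<open>\<epsilon> > 0\<close>]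
  proof eventually_elim
    case (elim n)
    have "rho h (lam n) (\<beta> n) f \<le> - Q s + \<epsilon>"
    proof (rule rho_least[where h = h and e = f, OF ham' prim' lam(1)])
      fix w assume "subsol (lam n) (h f) w" "w 0 \<le> \<beta> n"
      then obtain w' where w': "subsol (lam n) (h f) w'" "w 1 \<le> w' 1"
        "\<forall>s\<in>{0..1}. w' 1 - w' s \<le> Q' 1 - Q' s + \<epsilon>"
        using elim by blast
      have "w' (1 - s) \<le> 0"
        by (rule subsol_nonpos[OF w'(1) lam(1)]) (use rev nonneg s in auto)
      moreover have "w' 1 - w' (1 - s) \<le> Q' 1 - Q' (1 - s) + \<epsilon>" using w'(3) s by auto
      ultimately show "w 1 \<le> - Q s + \<epsilon>"
        using w'(2) maximal_primitive_reverse[OF ham nonneg rev prim prim' s] by linarith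
    qed
    then show ?case using le[of n] by simp
  qed
  then have "a \<le> - Q s + \<epsilon>" using tendsto_upperbound[OF \<alpha>] by simp
  then show "a + Q s \<le> 0 + \<epsilon>" by simp
qed

text \<open>Convergence can fail on an arc where the minimum is \<open>0\<close> and \<open>a + Q\<close> becomes positive, since all
  competitors are nonpositive there. The last hypothesis excludes this; solutions of the discrete
  equation fulfil it because the reversed arc ends at the origin of \<open>e\<close>.\<close>

lemma rho_tendsto:
  assumes ham: "hamiltonian (h e)" and ham': "hamiltonian (h f)"
    and prim: "maximal_primitive (h e) q Q" and prim': "maximal_primitive (h f) q' Q'"
    and rev: "\<And>s p. s \<in> {0..1} \<Longrightarrow> h f s p = h e (1 - s) (- p)"
    and lam: "\<And>n. lam n > 0" "lam \<longlonglongrightarrow> 0" and \<beta>: "\<beta> \<longlonglongrightarrow> b" and \<alpha>: "\<alpha> \<longlonglongrightarrow> a"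
    and le: "\<And>n. \<alpha> n \<le> rho h (lam n) (\<beta> n) f"
  shows "(\<lambda>n. rho h (lam n) (\<alpha> n) e) \<longlonglongrightarrow> a + sigma h e"
proof -
  have ge: "\<forall>\<^sub>F n in sequentially. \<alpha> n + Q 1 - \<epsilon> \<le> rho h (lam n) (\<alpha> n) e" if \<epsilon>: "\<epsilon> > 0" for \<epsilon>
  proof (cases "\<forall>s\<in>{0..1}. \<exists>p. h e s p < 0")
    case True
    then show ?thesis by (intro rho_eventually_ge_negative_minimum[where h = h and e = e, OF ham prim _ lam \<alpha> \<epsilon>]) auto
  next
    case False
    obtain c where c: "\<And>s. s \<in> {0..1} \<Longrightarrow> (\<exists>p. h e s p = c) \<and> (\<forall>p. c \<le> h e s p)"
      using ham unfolding hamiltonian_def by metis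
    have "0 \<le> h e s p" if "s \<in> {0..1}" for s p
      using False c that by (metis linorder_not_less order_trans)
    then have "a + Q s \<le> 0" if "s \<in> {0..1}" for s
      using limit_nonpositive_along_arc[where h = h and e = e and f = f, OF ham ham' prim prim' rev _ lam \<beta> \<alpha> le that] by blast
    then show ?thesis by (intro rho_eventually_ge_nonpositive[where h = h and e = e, OF ham prim _ lam(1) \<alpha> \<epsilon>]) auto
  qed
  have "(\<lambda>n. rho h (lam n) (\<alpha> n) e - (\<alpha> n + Q 1)) \<longlonglongrightarrow> 0"
  proof (rule tendstoI)
    fix \<epsilon> :: real assume "\<epsilon> > 0"
    then have "\<epsilon> / 2 > 0" by simp
    from ge[OF this] rho_eventually_le[where h = h and e = e, OF ham prim lam \<alpha> this]
    show "\<forall>\<^sub>F n in sequentially. dist (rho h (lam n) (\<alpha> n) e - (\<alpha> n + Q 1)) 0 < \<epsilon>"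
      by eventually_elim (use \<open>\<epsilon> > 0\<close> in \<open>simp add: dist_real_def abs_if\<close>)
  qed
  then have "(\<lambda>n. (rho h (lam n) (\<alpha> n) e - (\<alpha> n + Q 1)) + (\<alpha> n + Q 1)) \<longlonglongrightarrow> 0 + (a + Q 1)"
    by (intro tendsto_intros \<alpha>)
  then show ?thesis using sigma_eq_maximal_primitive[where h = h and e = e, OF prim] by simp
qed

section \<open>Paths and cycles in the graph\<close>

lemma joins_Cons:
  "joins E \<Psi> (e # \<xi>) x y \<longleftrightarrow>
     e \<in> E \<and> \<Psi> e 0 = x \<and> (if \<xi> = [] then \<Psi> e 1 = y else joins E \<Psi> \<xi> (\<Psi> e 1) y)"
  by (cases \<xi>) (auto simp: joins_def)

lemma joins_append:
  assumes "joins E \<Psi> \<xi> x y" "joins E \<Psi> \<zeta> y z"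
  shows "joins E \<Psi> (\<xi> @ \<zeta>) x z"
  using assms by (auto simp: joins_def successively_append_iff)

lemma foldl_along_path:
  assumes "joins E \<Psi> \<xi> x y" "\<And>e. e \<in> set \<xi> \<Longrightarrow> W (\<Psi> e 1) = F (W (\<Psi> e 0)) e"
  shows "foldl F (W x) \<xi> = W y"
  using assms
proof (induction \<xi> arbitrary: x)
  case Nil
  then show ?case by (simp add: joins_def)
next
  case (Cons e \<xi>)
  have e: "F (W x) e = W (\<Psi> e 1)" using Cons.prems(1) Cons.prems(2)[of e] by (simp add: joins_Cons)
  show ?case
  proof (cases "\<xi> = []")
    case True
    then show ?thesis using Cons.prems e by (simp add: joins_Cons)
  next
    case False
    then have "joins E \<Psi> \<xi> (\<Psi> e 1) y" using Cons.prems by (simp add: joins_Cons)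
    then have "foldl F (W (\<Psi> e 1)) \<xi> = W y" by (rule Cons.IH) (rule Cons.prems(2), simp)
    then show ?thesis by (simp only: foldl_Cons e)
  qed
qed

lemma sigma_path_ge_increment:
  assumes "joins E \<Psi> \<xi> x y" "\<And>e. e \<in> E \<Longrightarrow> W (\<Psi> e 1) \<le> W (\<Psi> e 0) + sigma h e"
  shows "W y \<le> W x + sigma_path h \<xi>"
  using assms(1)
proof (induction \<xi> arbitrary: x)
  case Nil
  then show ?case by (simp add: joins_def)
next
  case (Cons e \<xi>)
  then have e: "W (\<Psi> e 1) \<le> W x + sigma h e" using assms(2) by (auto simp: joins_Cons)
  show ?case
  proof (cases "\<xi> = []")
    case True
    then show ?thesis using Cons.prems e by (simp add: joins_Cons sigma_path_def)
  next
    case False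
    then have "joins E \<Psi> \<xi> (\<Psi> e 1) y" using Cons.prems by (simp add: joins_Cons)
    then have "W y \<le> W (\<Psi> e 1) + sigma_path h \<xi>" by (rule Cons.IH)
    then show ?thesis using e by (simp add: sigma_path_def)
  qed
qed

lemma foldl_plus_sigma: "foldl (\<lambda>\<alpha> e. \<alpha> + sigma h e) a \<xi> = a + sigma_path h \<xi>"
  by (induction \<xi> arbitrary: a) (auto simp: sigma_path_def)

text \<open>If an edge \<open>\<pi> x\<close> into each vertex \<open>x\<close> is selected, following the selected edges backwards from
  \<open>x\<close> runs into a cycle, since there are finitely many vertices.\<close>

lemma selected_edges_reach_cycle:
  assumes fin: "finite X" and x: "x \<in> X"
    and \<pi>: "\<And>x. x \<in> X \<Longrightarrow> \<pi> x \<in> E \<and> \<Psi> (\<pi> x) 1 = x \<and> \<Psi> (\<pi> x) 0 \<in> X"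
  shows "\<exists>y\<in>X. \<exists>\<xi> \<zeta>. joins E \<Psi> \<xi> y y \<and> joins E \<Psi> \<zeta> y x \<and> set \<xi> \<subseteq> \<pi> ` X \<and> set \<zeta> \<subseteq> \<pi> ` X"
proof -
  define f where "f x = \<Psi> (\<pi> x) 0" for x
  have f: "f x \<in> X" if "x \<in> X" for x using \<pi>[OF that] by (simp add: f_def)
  then have iter: "(f ^^ n) x \<in> X" for n using x by (induction n) auto
  have path: "\<exists>\<xi>. joins E \<Psi> \<xi> ((f ^^ Suc n) z) z \<and> set \<xi> \<subseteq> \<pi> ` X" if "z \<in> X" for n z
    using that
  proof (induction n arbitrary: z)
    case 0
    then show ?case using \<pi>[OF 0] by (intro exI[of _ "[\<pi> z]"]) (auto simp: joins_Cons f_def)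
  next
    case (Suc n)
    obtain \<xi> where \<xi>: "joins E \<Psi> \<xi> ((f ^^ Suc n) (f z)) (f z)" "set \<xi> \<subseteq> \<pi> ` X"
      using Suc.IH[OF f[OF Suc.prems]] by blast
    have "joins E \<Psi> [\<pi> z] (f z) z" using \<pi>[OF Suc.prems] by (auto simp: joins_Cons f_def)
    then have "joins E \<Psi> (\<xi> @ [\<pi> z]) ((f ^^ Suc n) (f z)) z" by (rule joins_append[OF \<xi>(1)])
    moreover have "(f ^^ Suc n) (f z) = (f ^^ Suc (Suc n)) z" by (simp only: funpow_Suc_right o_def)
    ultimately show ?case using \<xi>(2) Suc.prems by (intro exI[of _ "\<xi> @ [\<pi> z]"]) auto
  qed
  have "\<not> inj (\<lambda>n. (f ^^ n) x)"
  proof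
    assume "inj (\<lambda>n. (f ^^ n) x)"
    then have "infinite (range (\<lambda>n. (f ^^ n) x))" by (rule range_inj_infinite)
    moreover have "range (\<lambda>n. (f ^^ n) x) \<subseteq> X" using iter by auto
    ultimately show False using fin finite_subset by blast
  qed
  then obtain i j where ij: "i < j" "(f ^^ i) x = (f ^^ j) x"
    unfolding inj_def by (metis linorder_neqE_nat)
  obtain m where m: "j = Suc m + i" using ij(1) by (metis add.commute less_iff_Suc_add add_Suc_right)
  obtain n where n: "j = Suc n" using ij(1) by (cases j) auto
  define y where "y = (f ^^ j) x"
  have "(f ^^ Suc m) ((f ^^ i) x) = y" unfolding y_def m by (simp only: funpow_add o_def)
  then have "(f ^^ Suc m) y = y" using ij(2) by (simp only: y_def)
  then obtain \<xi> where "joins E \<Psi> \<xi> y y" "set \<xi> \<subseteq> \<pi> ` X"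
    using path[of y m] iter[of j] by (auto simp only: y_def)
  moreover obtain \<zeta> where "joins E \<Psi> \<zeta> y x" "set \<zeta> \<subseteq> \<pi> ` X"
    using path[OF x, of n] by (auto simp only: y_def n)
  ultimately show ?thesis using iter[of j] unfolding y_def by blast
qed

text \<open>Along a path no step increases the distance between two values; with a strict first step this leaves
  room for one fixed point only.\<close>

lemma foldl_nonexpansive:
  fixes F :: "real \<Rightarrow> 'e \<Rightarrow> real"
  assumes mono: "\<And>e a b. e \<in> set \<xi> \<Longrightarrow> a \<le> b \<Longrightarrow> F a e \<le> F b e"
    and contr: "\<And>e a b. e \<in> set \<xi> \<Longrightarrow> a < b \<Longrightarrow> F b e < F a e + (b - a)"
    and "a \<le> b"
  shows "foldl F a \<xi> \<le> foldl F b \<xi> \<and> foldl F b \<xi> \<le> foldl F a \<xi> + (b - a)"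
  using assms
proof (induction \<xi> arbitrary: a b)
  case (Cons e \<xi>)
  have "F a e \<le> F b e" using Cons.prems by simp
  moreover have "F b e \<le> F a e + (b - a)"
    using Cons.prems(2)[of e a b] Cons.prems(3) by (cases "a = b") auto
  moreover have "foldl F (F a e) \<xi> \<le> foldl F (F b e) \<xi> \<and>
      foldl F (F b e) \<xi> \<le> foldl F (F a e) \<xi> + (F b e - F a e)"
    using Cons.prems calculation(1) by (intro Cons.IH) auto
  ultimately show ?case by auto
qed simp

lemma foldl_fixed_point_unique:
  fixes F :: "real \<Rightarrow> 'e \<Rightarrow> real"
  assumes mono: "\<And>e a b. e \<in> set \<xi> \<Longrightarrow> a \<le> b \<Longrightarrow> F a e \<le> F b e"
    and contr: "\<And>e a b. e \<in> set \<xi> \<Longrightarrow> a < b \<Longrightarrow> F b e < F a e + (b - a)"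
    and "\<xi> \<noteq> []" and fixed: "foldl F a \<xi> = a" "foldl F b \<xi> = b"
  shows "a = b"
proof -
  obtain e \<zeta> where \<xi>: "\<xi> = e # \<zeta>" using \<open>\<xi> \<noteq> []\<close> by (cases \<xi>) auto
  have False if less: "x < y" and fx: "foldl F x \<xi> = x" and fy: "foldl F y \<xi> = y" for x y
  proof -
    have "F x e \<le> F y e" "F y e < F x e + (y - x)" using mono contr less by (auto simp: \<xi>)
    moreover have "foldl F (F y e) \<zeta> \<le> foldl F (F x e) \<zeta> + (F y e - F x e)"
      using foldl_nonexpansive[of \<zeta> F "F x e" "F y e"] mono contr calculation(1) by (auto simp: \<xi>)
    ultimately show False using fx fy by (simp add: \<xi>)
  qed
  then show ?thesis using fixed by (meson linorder_neqE_linordered_idom)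
qed

text \<open>Membership in the Aubry set thus only requires that \<open>U\<^sub>\<lambda> y\<close> is reproduced along a cycle.\<close>

lemma beta_eqI:
  assumes solvable: "\<And>e. e \<in> E \<Longrightarrow> hamiltonian (h e) \<and> (\<exists>q Q. maximal_primitive (h e) q Q)"
    and l: "l > 0" and cycle: "joins E \<Psi> \<xi> y y" and fixed: "rho_path h l \<alpha> \<xi> = \<alpha>"
  shows "beta h l \<xi> = \<alpha>"
proof -
  have in_E: "set \<xi> \<subseteq> E" and ne: "\<xi> \<noteq> []" using cycle by (auto simp: joins_def)
  have mono: "rho h l a e \<le> rho h l b e" if e: "e \<in> set \<xi>" and "a \<le> b" for e a b
  proof -
    obtain q Q where "hamiltonian (h e)" "maximal_primitive (h e) q Q"
      using solvable in_E e by blast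
    then show ?thesis using l \<open>a \<le> b\<close> by (rule rho_mono)
  qed
  have contr: "rho h l b e < rho h l a e + (b - a)" if e: "e \<in> set \<xi>" and "a < b" for e a b
  proof -
    obtain q Q where "hamiltonian (h e)" "maximal_primitive (h e) q Q"
      using solvable in_E e by blast
    then show ?thesis using l \<open>a < b\<close> by (rule rho_strict_contraction)
  qed
  show ?thesis
    unfolding beta_def
  proof (rule the_equality, rule fixed)
    show "\<alpha>' = \<alpha>" if "rho_path h l \<alpha>' \<xi> = \<alpha>'" for \<alpha>'
      by (rule foldl_fixed_point_unique[where F = "rho h l", OF mono contr ne])
        (use that fixed in \<open>auto simp: rho_path_def\<close>)
  qed
qed

section \<open>Vanishing discount limit on the network\<close>

theorem proposition8p9:
  fixes \<A> :: "(real \<Rightarrow> 'a::euclidean_space) set"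
    and H :: "(real \<Rightarrow> 'a) \<Rightarrow> real \<Rightarrow> real \<Rightarrow> real"
    and E :: "'e set"
    and \<Psi> :: "'e \<Rightarrow> real \<Rightarrow> 'a"
    and U :: "real \<Rightarrow> 'a \<Rightarrow> real"
    and lam :: "nat \<Rightarrow> real"
    and V :: "'a \<Rightarrow> real"
  defines "h \<equiv> \<lambda>e. H (\<Psi> e)"
  assumes "network \<A>"
    and "network_hamiltonian \<A> H"
    and "critical_value \<A> H 0"
    and "bij_betw \<Psi> E \<A>"
    and "\<And>l. l > 0 \<Longrightarrow> discrete_solution (vertices \<A>) E \<Psi> (rho h l) (U l)"
    and "\<And>n. lam n > 0"
    and "lam \<longlonglongrightarrow> 0"
    and "\<And>x. x \<in> vertices \<A> \<Longrightarrow> (\<lambda>n. U (lam n) x) \<longlonglongrightarrow> V x"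
  shows "discrete_solution (vertices \<A>) E \<Psi> (\<lambda>\<alpha> e. \<alpha> + sigma h e) V \<and>
    (\<forall>x\<in>vertices \<A>.
       is_minimum {V y + sigma_path h \<xi> | y \<xi>.
                     y \<in> limit_aubry (vertices \<A>) E \<Psi> h U \<and> joins E \<Psi> \<xi> y x} (V x))"
proof -
  note network = assms(2) and hams = assms(3) and critical = assms(4) and bij = assms(5)
    and U_solves = assms(6) and lam = assms(7,8) and U_lim = assms(9)
  let ?X = "vertices \<A>"
  let ?o = "\<lambda>e. \<Psi> e 0" and ?t = "\<lambda>e. \<Psi> e 1"
  have finA: "finite \<A>" using network by (simp add: network_def)
  have finE: "finite E" using bij_betw_finite[OF bij] finA by simp
  have "vertices \<A> = (\<lambda>\<gamma>. \<gamma> 0) ` \<A> \<union> (\<lambda>\<gamma>. \<gamma> 1) ` \<A>" by (auto simp: vertices_def)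
  then have finX: "finite ?X" using finA by simp
  have \<Psi>: "\<Psi> e \<in> \<A>" if "e \<in> E" for e using bij that by (auto simp: bij_betw_def)
  have ends: "?o e \<in> ?X" "?t e \<in> ?X" if "e \<in> E" for e
    using \<Psi>[OF that] by (auto simp: vertices_def)
  have reverse: "\<exists>f\<in>E. \<Psi> f = reversepath (\<Psi> e)" if "e \<in> E" for e
  proof -
    have "reversepath (\<Psi> e) \<in> \<A>" using network \<Psi>[OF that] by (simp add: network_def)
    then show ?thesis using bij by (metis bij_betw_def imageE)
  qed
  obtain u where u: "eikonal_solution \<A> (\<lambda>\<gamma> s p. H \<gamma> s p - 0) u"
    using critical unfolding critical_value_def by blast
  have solvable: "hamiltonian (h e) \<and> (\<exists>q Q. maximal_primitive (h e) q Q)" if e: "e \<in> E" for e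
  proof -
    have ham: "hamiltonian (h e)" using hams \<Psi>[OF e] by (simp add: network_hamiltonian_def h_def)
    have "subsol 0 (h e) (u \<circ> \<Psi> e)" using u \<Psi>[OF e] by (simp add: eikonal_solution_def h_def)
    then show ?thesis
      using ham maximal_primitive_exists[OF ham] hamiltonian_minimum_nonpos[OF ham] by blast
  qed
  have incoming: "finite {e \<in> E. ?t e = x}" "{e \<in> E. ?t e = x} \<noteq> {}" if "x \<in> ?X" for x
  proof -
    show "finite {e \<in> E. ?t e = x}" using finE by simp
    have "\<exists>e\<in>E. ?o e = x \<or> ?t e = x"
      using that bij unfolding vertices_def bij_betw_def by blast
    then show "{e \<in> E. ?t e = x} \<noteq> {}"
      using reverse by (force simp: reversepath_def)
  qed
  have U_le: "U (lam n) (?t e) \<le> rho h (lam n) (U (lam n) (?o e)) e" if e: "e \<in> E" for n e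
  proof -
    have "U (lam n) (?t e) = Min ((\<lambda>f. rho h (lam n) (U (lam n) (?o f)) f) ` {f \<in> E. ?t f = ?t e})"
      using U_solves[OF lam(1)] ends(2)[OF e] by (simp add: discrete_solution_def)
    also have "\<dots> \<le> rho h (lam n) (U (lam n) (?o e)) e"
      using incoming[OF ends(2)[OF e]] e by (intro Min_le) auto
    finally show ?thesis .
  qed
  have rho_lim: "(\<lambda>n. rho h (lam n) (U (lam n) (?o e)) e) \<longlonglongrightarrow> V (?o e) + sigma h e" if e: "e \<in> E" for e
  proof -
    obtain f where f: "f \<in> E" "\<Psi> f = reversepath (\<Psi> e)" using reverse[OF e] by blast
    have rev: "h f s p = h e (1 - s) (- p)" if "s \<in> {0..1}" for s p
      using hams \<Psi>[OF e] that f(2) by (simp add: network_hamiltonian_def h_def)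
    have f_ends: "?o f = ?t e" "?t f = ?o e" using f(2) by (auto simp: reversepath_def)
    have \<beta>: "(\<lambda>n. U (lam n) (?t e)) \<longlonglongrightarrow> V (?t e)" and \<alpha>: "(\<lambda>n. U (lam n) (?o e)) \<longlonglongrightarrow> V (?o e)"
      using U_lim ends[OF e] by auto
    have le: "U (lam n) (?o e) \<le> rho h (lam n) (U (lam n) (?t e)) f" for n
      using U_le[OF f(1), of n] by (simp add: f_ends)
    obtain q Q q' Q' where prims: "hamiltonian (h e)" "hamiltonian (h f)"
      "maximal_primitive (h e) q Q" "maximal_primitive (h f) q' Q'"
      using solvable[OF e] solvable[OF f(1)] by blast
    show ?thesis by (rule rho_tendsto[OF prims rev lam \<beta> \<alpha> le])
  qed
  have V_le: "V (?t e) \<le> V (?o e) + sigma h e" if e: "e \<in> E" for e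
    by (rule LIMSEQ_le[OF U_lim[OF ends(2)[OF e]] rho_lim[OF e]]) (use U_le[OF e] in auto)

  \<comment> \<open>Optimal edges for the parameters \<open>lam n\<close>; finitely many choices, so one recurs infinitely often.\<close>
  have "\<exists>\<pi>. \<pi> \<in> ?X \<rightarrow>\<^sub>E E \<and> (\<forall>x\<in>?X. ?t (\<pi> x) = x \<and> U (lam n) x = rho h (lam n) (U (lam n) (?o (\<pi> x))) (\<pi> x))"
    for n
  proof -
    have "\<exists>e. e \<in> E \<and> ?t e = x \<and> U (lam n) x = rho h (lam n) (U (lam n) (?o e)) e" if x: "x \<in> ?X" for x
    proof -
      have "U (lam n) x = Min ((\<lambda>e. rho h (lam n) (U (lam n) (?o e)) e) ` {e \<in> E. ?t e = x})"
        using U_solves[OF lam(1)] x by (simp add: discrete_solution_def)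
      also have "\<dots> \<in> (\<lambda>e. rho h (lam n) (U (lam n) (?o e)) e) ` {e \<in> E. ?t e = x}"
        using incoming[OF x] by (intro Min_in) auto
      finally show ?thesis by auto
    qed
    then have "\<exists>\<pi>. \<forall>x\<in>?X. \<pi> x \<in> E \<and> ?t (\<pi> x) = x \<and>
      U (lam n) x = rho h (lam n) (U (lam n) (?o (\<pi> x))) (\<pi> x)"
      by (intro bchoice) blast
    then obtain \<pi> where "\<forall>x\<in>?X. \<pi> x \<in> E \<and> ?t (\<pi> x) = x \<and>
      U (lam n) x = rho h (lam n) (U (lam n) (?o (\<pi> x))) (\<pi> x)" ..
    then show ?thesis by (intro exI[of _ "restrict \<pi> ?X"]) simp
  qed
  then have "\<forall>n\<in>UNIV. \<exists>\<pi>\<in>?X \<rightarrow>\<^sub>E E.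
      \<forall>x\<in>?X. ?t (\<pi> x) = x \<and> U (lam n) x = rho h (lam n) (U (lam n) (?o (\<pi> x))) (\<pi> x)"
    by blast
  from pigeonhole_infinite_rel[OF infinite_UNIV_nat finite_PiE[OF finX finE] this]
  obtain \<pi> where \<pi>: "\<pi> \<in> ?X \<rightarrow>\<^sub>E E" and inf: "infinite {n \<in> UNIV. \<forall>x\<in>?X. ?t (\<pi> x) = x \<and>
      U (lam n) x = rho h (lam n) (U (lam n) (?o (\<pi> x))) (\<pi> x)}"
    by (rule bexE)
  obtain r :: "nat \<Rightarrow> nat" where r: "strict_mono r"
    and r_opt: "\<forall>n. r n \<in> {n \<in> UNIV. \<forall>x\<in>?X. ?t (\<pi> x) = x \<and>
      U (lam n) x = rho h (lam n) (U (lam n) (?o (\<pi> x))) (\<pi> x)}"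
    using infinite_enumerate[OF inf] by (elim exE conjE)
  have opt: "?t (\<pi> x) = x"
    "U (lam (r n)) x = rho h (lam (r n)) (U (lam (r n)) (?o (\<pi> x))) (\<pi> x)" if "x \<in> ?X" for n x
    using r_opt[rule_format, of n] that by blast+
  have \<pi>_edge: "\<pi> x \<in> E \<and> ?t (\<pi> x) = x \<and> ?o (\<pi> x) \<in> ?X" if "x \<in> ?X" for x
    using PiE_mem[OF \<pi> that] opt(1)[OF that] ends(1) by blast
  have V_opt: "V x = V (?o (\<pi> x)) + sigma h (\<pi> x)" if x: "x \<in> ?X" for x
  proof (rule LIMSEQ_unique)
    show "(\<lambda>n. U (lam (r n)) x) \<longlonglongrightarrow> V x"
      using LIMSEQ_subseq_LIMSEQ[OF U_lim[OF x] r] by (simp add: o_def)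
    have "(\<lambda>n. rho h (lam (r n)) (U (lam (r n)) (?o (\<pi> x))) (\<pi> x)) \<longlonglongrightarrow> V (?o (\<pi> x)) + sigma h (\<pi> x)"
      using LIMSEQ_subseq_LIMSEQ[OF rho_lim[of "\<pi> x"] r] \<pi>_edge[OF x] by (simp add: o_def)
    then show "(\<lambda>n. U (lam (r n)) x) \<longlonglongrightarrow> V (?o (\<pi> x)) + sigma h (\<pi> x)"
      by (simp only: opt(2)[OF x, symmetric])
  qed

  have discrete: "discrete_solution ?X E \<Psi> (\<lambda>\<alpha> e. \<alpha> + sigma h e) V"
    unfolding discrete_solution_def
  proof
    fix x assume x: "x \<in> ?X"
    show "V x = Min ((\<lambda>e. V (?o e) + sigma h e) ` {e \<in> E. ?t e = x})"
    proof (rule Min_eqI[symmetric])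
      show "finite ((\<lambda>e. V (?o e) + sigma h e) ` {e \<in> E. ?t e = x})" using incoming[OF x] by simp
      show "V x \<le> y" if "y \<in> (\<lambda>e. V (?o e) + sigma h e) ` {e \<in> E. ?t e = x}" for y
        using that V_le by auto
      show "V x \<in> (\<lambda>e. V (?o e) + sigma h e) ` {e \<in> E. ?t e = x}"
        using V_opt[OF x] \<pi>_edge[OF x] by blast
    qed
  qed
  have minimum: "is_minimum {V y + sigma_path h \<xi> | y \<xi>. y \<in> limit_aubry ?X E \<Psi> h U \<and> joins E \<Psi> \<xi> y x} (V x)"
    if x: "x \<in> ?X" for x
    unfolding is_minimum_def
  proof
    show "\<forall>z\<in>{V y + sigma_path h \<xi> | y \<xi>. y \<in> limit_aubry ?X E \<Psi> h U \<and> joins E \<Psi> \<xi> y x}. V x \<le> z"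
      using sigma_path_ge_increment[of E \<Psi> _ _ x V h] V_le by blast
    obtain y \<xi> \<zeta> where y: "y \<in> ?X" and \<xi>: "joins E \<Psi> \<xi> y y" "set \<xi> \<subseteq> \<pi> ` ?X"
      and \<zeta>: "joins E \<Psi> \<zeta> y x" "set \<zeta> \<subseteq> \<pi> ` ?X"
      using selected_edges_reach_cycle[OF finX x \<pi>_edge] by blast
    have "y \<in> aubry ?X E \<Psi> h U (lam (r n))" for n
    proof -
      have "rho_path h (lam (r n)) (U (lam (r n)) y) \<xi> = U (lam (r n)) y"
        unfolding rho_path_def
      proof (rule foldl_along_path[OF \<xi>(1)])
        fix e assume "e \<in> set \<xi>"
        then obtain z where z: "z \<in> ?X" "e = \<pi> z" using \<xi>(2) by blast
        show "U (lam (r n)) (?t e) = rho h (lam (r n)) (U (lam (r n)) (?o e)) e"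
          using opt[OF z(1)] unfolding z(2) by metis
      qed
      then have "beta h (lam (r n)) \<xi> = U (lam (r n)) y"
        by (intro beta_eqI[OF solvable lam(1) \<xi>(1)])
      then have "joins E \<Psi> \<xi> y y \<and> U (lam (r n)) y = beta h (lam (r n)) \<xi>" using \<xi>(1) by simp
      then show ?thesis unfolding aubry_def using y by blast
    qed
    moreover have "(\<lambda>n. lam (r n)) \<longlonglongrightarrow> 0"
      using LIMSEQ_subseq_LIMSEQ[OF lam(2) r] by (simp add: o_def)
    ultimately have "y \<in> limit_aubry ?X E \<Psi> h U"
      unfolding limit_aubry_def
      using y lam(1) by (auto intro!: exI[of _ "\<lambda>n. lam (r n)"])
    moreover have "V x = V y + sigma_path h \<zeta>"
    proof -
      have "foldl (\<lambda>\<alpha> e. \<alpha> + sigma h e) (V y) \<zeta> = V x"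
      proof (rule foldl_along_path[OF \<zeta>(1)])
        fix e assume "e \<in> set \<zeta>"
        then obtain z where z: "z \<in> ?X" "e = \<pi> z" using \<zeta>(2) by blast
        show "V (?t e) = V (?o e) + sigma h e"
          using V_opt[OF z(1)] \<pi>_edge[OF z(1)] unfolding z(2) by metis
      qed
      then show ?thesis by (simp only: foldl_plus_sigma)
    qed
    ultimately show "V x \<in> {V y + sigma_path h \<xi> | y \<xi>. y \<in> limit_aubry ?X E \<Psi> h U \<and> joins E \<Psi> \<xi> y x}"
      using \<zeta>(1) by blast
  qed
  show ?thesis using discrete minimum by blast
qed

end
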